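(* Let $w$ be any word. Suppose the snake graph $G_w$ is built from $d$ maximal straight segments. Then the rank function $\mathbb L_w(q)$ can be written as $$\mathbb L_w(q)=\sum_{L\in\mathbb L(\mathbb G_w)}q_L,$$ where $\mathbb G_w$ is the edge- and face-weighted zigzag snake graph with $d-1$ tiles defined in the context, $\mathbb L(\mathbb G_w)$ is its poset of lattice paths, and $q_L$ is the weight of $L$.
   Context: A snake graph with $n$ tiles is a planar graph in $\mathbb Z^2$ formed by unit squares $T_1,\dots,T_n$, where each $T_{i+1}$ is glued directly to the right of or directly above $T_i$; it is zigzag if no three consecutive tiles are in one row or column. Its shape is the word of length $n-1$ whose $i$-th letter is $a$ (resp. $b$) if $T_{i+1}$ is right of (resp. above) $T_i$. For a word $w=w_1\cdots w_{n-1}$ over $\{a,b\}$, $G_w$ is the snake graph of shape $w^*=w_1^*w_2w_3^*w_4\cdots$, $a^*=b$, $b^*=a$. A lattice path on a snake graph is a path of unit steps right or up along its edges from the SW vertex of the first tile to the NE vertex of the last tile; $L_2$ covers $L_1$ iff $L_2$ arises from $L_1$ by replacing the S and E edges of a tile by its W and N edges. The resulting poset (for $G_w$ denoted $\mathbb L_w$) is a graded distributive lattice whose minimal element $L_-$ consists of boundary edges and contains the S edge of the first tile. $\mathbb L_w(q)=\sum_ir_iq^i$, $r_i$ the number of paths of rank $i$ in $\mathbb L_w$. Decompose $G_w$ into its $d\geq 2$ maximal overlapping straight segments: $k_1$ is the number of tiles of the first row or column, $k_d$ that of the last, and $k_i+1$ the number of tiles of the $i$-th row or column for $1<i<d$.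 Write $[k]_q=1+q+\dots+q^{k-1}$. Construction of $\mathbb G_w$: reflect $G_w$ about the antidiagonal (SW–NE line) of its first tile and regard the result as the "middle" lattice path $\Lambda$ of $\mathbb G_w$, the $i$-th straight segment being regarded as the $i$-th step. That is, $\Lambda$ has $d$ unit steps alternating between up and right, the first step being up if $G_w$ starts by going right and right if $G_w$ starts by going up, and $\mathbb G_w$ is the zigzag snake graph with tiles $\mathbb T_1,\dots,\mathbb T_{d-1}$ such that the $j$-th and $(j+1)$-st steps of $\Lambda$ are two sides of $\mathbb T_j$. The edge of $\mathbb G_w$ that is the $i$-th step of $\Lambda$ has weight $[k_i]_q$; all other edges have weight $1$. The tile (face) $\mathbb T_j$ has weight $q$ if the two steps of $\Lambda$ on it are its W and N sides, and $q^{k_j+k_{j+1}-1}$ if they are its S and E sides. The weight $q_L$ of a lattice path $L$ on $\mathbb G_w$ is the product of the weights of its edges times the product of the face weights of the tiles enclosed by the symmetric difference $L\ominus L_-$, $L_-$ the minimal lattice path of $\mathbb G_w$. *)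

theory Defs
  imports "HOL-Analysis.Analysis" "HOL-Computational_Algebra.Polynomial"
begin

section \<open>Words, shapes and snake graphs\<close>

text \<open>The letter \<open>La\<close> means "right" and \<open>Lb\<close> means "up".\<close>

datatype letter = La | Lb

fun flip :: "letter \<Rightarrow> letter" where
  "flip La = Lb"
| "flip Lb = La"

fun word_star :: "letter list \<Rightarrow> letter list" where
  "word_star [] = []"
| "word_star [x] = [flip x]"
| "word_star (x # y # w) = flip x # y # word_star w"

type_synonym point = "int \<times> int"

text \<open>A unit edge \<open>(u, v)\<close> is stored with \<open>v\<close> directly to the right of or above \<open>u\<close>;
  a unit square (tile) is stored as its SW corner.\<close>

type_synonym edge = "point \<times> point"

fun move :: "letter \<Rightarrow> point \<Rightarrow> point" where
  "move La (x, y) = (x + 1, y)"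
| "move Lb (x, y) = (x, y + 1)"

definition S_edge :: "point \<Rightarrow> edge" where "S_edge t = (t, move La t)"
definition W_edge :: "point \<Rightarrow> edge" where "W_edge t = (t, move Lb t)"
definition E_edge :: "point \<Rightarrow> edge" where "E_edge t = (move La t, move Lb (move La t))"
definition N_edge :: "point \<Rightarrow> edge" where "N_edge t = (move Lb t, move La (move Lb t))"

fun points_from :: "point \<Rightarrow> letter list \<Rightarrow> point list" where
  "points_from p [] = [p]"
| "points_from p (x # xs) = p # points_from (move x p) xs"

fun steps_from :: "point \<Rightarrow> letter list \<Rightarrow> edge list" where
  "steps_from p [] = []"
| "steps_from p (x # xs) = (p, move x p) # steps_from (move x p) xs"

text \<open>The snake graph of shape \<open>u\<close>, given by its list of tiles starting at the origin.\<close>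

definition snake :: "letter list \<Rightarrow> point list" where
  "snake u = points_from (0, 0) u"

definition snake_edges :: "point list \<Rightarrow> edge set" where
  "snake_edges ts = (\<Union>t\<in>set ts. {S_edge t, E_edge t, N_edge t, W_edge t})"

section \<open>The poset of lattice paths\<close>

fun is_walk :: "edge set \<Rightarrow> point \<Rightarrow> edge list \<Rightarrow> point \<Rightarrow> bool" where
  "is_walk E u [] v \<longleftrightarrow> u = v"
| "is_walk E u (e # es) v \<longleftrightarrow> e \<in> E \<and> fst e = u \<and> is_walk E (snd e) es v"

text \<open>A lattice path is identified with its set of edges. This loses nothing, since all steps
  go right or up.\<close>

definition lattice_paths :: "point list \<Rightarrow> edge set set" where
  "lattice_paths ts =
     {set es | es. is_walk (snake_edges ts) (hd ts) es (move La (move Lb (last ts)))}"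

text \<open>\<open>(L1, L2) \<in> path_covers ts\<close> means that \<open>L2\<close> covers \<open>L1\<close>.\<close>

definition path_covers :: "point list \<Rightarrow> (edge set \<times> edge set) set" where
  "path_covers ts = {(L1, L2). L1 \<in> lattice_paths ts \<and> L2 \<in> lattice_paths ts \<and>
     (\<exists>t\<in>set ts. {S_edge t, E_edge t} \<subseteq> L1 \<and>
        L2 = (L1 - {S_edge t, E_edge t}) \<union> {W_edge t, N_edge t})}"

definition min_path :: "point list \<Rightarrow> edge set" where
  "min_path ts = (THE L. L \<in> lattice_paths ts \<and>
     (\<forall>L'\<in>lattice_paths ts. (L, L') \<in> (path_covers ts)\<^sup>*))"

text \<open>The rank of \<open>L\<close> is the common length of all saturated chains from the minimum to \<open>L\<close>.\<close>

definition path_rank :: "point list \<Rightarrow> edge set \<Rightarrow> nat" where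
  "path_rank ts L = (THE r. (min_path ts, L) \<in> path_covers ts ^^ r)"

definition num_of_rank :: "point list \<Rightarrow> nat \<Rightarrow> nat" where
  "num_of_rank ts i = card {L \<in> lattice_paths ts. path_rank ts L = i}"

text \<open>Rank functions and weights live in the polynomial ring over the integers in the
  indeterminate \<open>qv\<close>.\<close>

abbreviation qv :: "int poly" where "qv \<equiv> [:0, 1:]"

definition qint :: "nat \<Rightarrow> int poly" where
  "qint k = (\<Sum>i<k. qv ^ i)"

definition rank_function :: "point list \<Rightarrow> int poly" where
  "rank_function ts = (\<Sum>i | num_of_rank ts i \<noteq> 0. of_nat (num_of_rank ts i) * qv ^ i)"

definition snake_G :: "letter list \<Rightarrow> point list" where
  "snake_G w = snake (word_star w)"

section \<open>Maximal straight segments\<close>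

function runs :: "'a list \<Rightarrow> 'a list list" where
  "runs [] = []"
| "runs (x # xs) = (x # takeWhile (\<lambda>y. y = x) xs) # runs (dropWhile (\<lambda>y. y = x) xs)"
  by pat_completeness auto
termination
  by (relation "Wellfounded.measure length") (auto simp: less_Suc_eq_le length_dropWhile_le)

text \<open>A maximal row or column with \<open>m + 1 \<ge> 2\<close> tiles corresponds to a maximal block of \<open>m\<close> equal
  letters in the shape; consecutive rows and columns overlap in one tile. (For the one-tile snake
  graph there are no blocks; it is of no interest below, where at least two segments are
  required.)\<close>

definition segments :: "letter list \<Rightarrow> letter list list" where
  "segments w = runs (word_star w)"

definition num_segments :: "letter list \<Rightarrow> nat" where
  "num_segments w = length (segments w)"

definition segment_tiles :: "letter list \<Rightarrow> nat \<Rightarrow> nat" where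
  "segment_tiles w i = length (segments w ! i) + 1"

text \<open>Segments, steps and tiles are indexed from 0. The first and last segment have
  \<open>seg_k w i\<close> tiles, all the others have \<open>seg_k w i + 1\<close> tiles.\<close>

definition seg_k :: "letter list \<Rightarrow> nat \<Rightarrow> nat" where
  "seg_k w i = (if i = 0 \<or> i = num_segments w - 1 then segment_tiles w i
                else segment_tiles w i - 1)"

section \<open>The weighted zigzag snake graph\<close>

text \<open>Reflection in an antidiagonal (SW--NE line) exchanges "right" and "up", hence \<open>flip\<close>.\<close>

definition middle_dirs :: "letter list \<Rightarrow> letter list" where
  "middle_dirs w = map (\<lambda>s. flip (hd s)) (segments w)"

definition middle_path :: "letter list \<Rightarrow> edge list" where
  "middle_path w = steps_from (0, 0) (middle_dirs w)"

text \<open>If the steps \<open>j\<close> and \<open>j + 1\<close> of the middle path are the W and N sides, or the S and E sides,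
  of a unit square, then its SW corner is the starting point of step \<open>j\<close>. So the tiles are the
  starting points of all steps but the last, i.e.\ they form the snake graph whose shape is the
  word of directions without its last two letters; see the lemma \<open>zigzag_snake_sides\<close> below.\<close>

definition zigzag_snake :: "letter list \<Rightarrow> point list" where
  "zigzag_snake w = snake (take (num_segments w - 2) (middle_dirs w))"

definition edge_weight :: "letter list \<Rightarrow> edge \<Rightarrow> int poly" where
  "edge_weight w e =
     (if e \<in> set (middle_path w)
      then qint (seg_k w (THE i. i < num_segments w \<and> middle_path w ! i = e))
      else 1)"

definition face_weight :: "letter list \<Rightarrow> nat \<Rightarrow> int poly" where
  "face_weight w j =
     (let t = zigzag_snake w ! j in
      if middle_path w ! j = W_edge t \<and> middle_path w ! Suc j = N_edge t then qv
      else qv ^ (seg_k w j + seg_k w (Suc j) - 1))"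

definition real_point :: "point \<Rightarrow> real \<times> real" where
  "real_point p = (of_int (fst p), of_int (snd p))"

definition edges_region :: "edge set \<Rightarrow> (real \<times> real) set" where
  "edges_region C = (\<Union>(u, v)\<in>C. closed_segment (real_point u) (real_point v))"

text \<open>A tile is enclosed by a set of edges if its interior lies in bounded components of the
  complement of the edges in the plane.\<close>

definition encloses :: "edge set \<Rightarrow> point \<Rightarrow> bool" where
  "encloses C t \<longleftrightarrow>
     box (real_point t) (real_point (move La (move Lb t))) \<subseteq> inside (edges_region C)"

definition enclosed_tiles :: "letter list \<Rightarrow> edge set \<Rightarrow> nat set" where
  "enclosed_tiles w L =
     (let M = min_path (zigzag_snake w) in
      {j. j < length (zigzag_snake w) \<and> encloses ((L - M) \<union> (M - L)) (zigzag_snake w ! j)})"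

definition path_weight :: "letter list \<Rightarrow> edge set \<Rightarrow> int poly" where
  "path_weight w L = (\<Prod>e\<in>L. edge_weight w e) * (\<Prod>j\<in>enclosed_tiles w L. face_weight w j)"

section \<open>Consistency of the construction\<close>

lemma length_points_from [simp]: "length (points_from p u) = Suc (length u)"
  by (induction u arbitrary: p) auto

lemma length_zigzag_snake:
  "2 \<le> num_segments w \<Longrightarrow> length (zigzag_snake w) = num_segments w - 1"
  by (simp add: zigzag_snake_def snake_def middle_dirs_def num_segments_def)

lemma runs_eq_Nil_iff [simp]: "runs xs = [] \<longleftrightarrow> xs = []"
  by (cases xs) auto

lemma hd_hd_runs: "xs \<noteq> [] \<Longrightarrow> hd (hd (runs xs)) = hd xs"
  by (cases xs) auto

lemma distinct_adj_runs: "distinct_adj (map hd (runs xs))"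
proof (induction xs rule: runs.induct)
  case (2 x xs)
  let ?d = "dropWhile (\<lambda>y. y = x) xs"
  show ?case
  proof (cases "?d = []")
    case False
    then have "hd (map hd (runs ?d)) = hd ?d"
      by (simp add: hd_map hd_hd_runs)
    moreover have "hd ?d \<noteq> x"
      using hd_dropWhile[OF False] by simp
    ultimately show ?thesis
      using 2 False by (simp add: distinct_adj_Cons)
  next
    case True
    then show ?thesis by (simp del: dropWhile_eq_Nil_conv)
  qed
qed simp

lemma flip_eq_iff [simp]: "flip x = flip y \<longleftrightarrow> x = y"
  by (cases x; cases y) auto

lemma distinct_adj_middle_dirs: "distinct_adj (middle_dirs w)"
proof -
  have "middle_dirs w = map flip (map hd (segments w))"
    by (simp add: middle_dirs_def)
  moreover have "inj_on flip A" for A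
    by (simp add: inj_on_def)
  ultimately show ?thesis
    using distinct_adj_runs[of "word_star w"]
    by (simp only: segments_def distinct_adj_map_iff)
qed

lemma steps_from_sides:
  assumes "distinct_adj u" "Suc j < length u"
  shows "let t = points_from p (take (length u - 2) u) ! j in
    (steps_from p u ! j = W_edge t \<and> steps_from p u ! Suc j = N_edge t) \<or>
    (steps_from p u ! j = S_edge t \<and> steps_from p u ! Suc j = E_edge t)"
  using assms
proof (induction u arbitrary: p j)
  case (Cons x u)
  then obtain y v where u: "u = y # v" by (cases u) auto
  show ?case
  proof (cases j)
    case 0
    have "x \<noteq> y" using Cons.prems(1) u by simp
    moreover have "points_from p (take k z) ! 0 = p" for k z
      by (cases k; cases z) auto
    ultimately show ?thesis
      using 0 u by (cases x; cases y; cases p)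
        (auto simp: W_edge_def N_edge_def S_edge_def E_edge_def)
  next
    case (Suc i)
    then have "Suc i < length u" using Cons.prems(2) by simp
    moreover have "distinct_adj u" using Cons.prems(1) u by simp
    ultimately have IH: "let t = points_from (move x p) (take (length u - 2) u) ! i in
      (steps_from (move x p) u ! i = W_edge t \<and> steps_from (move x p) u ! Suc i = N_edge t) \<or>
      (steps_from (move x p) u ! i = S_edge t \<and> steps_from (move x p) u ! Suc i = E_edge t)"
      using Cons.IH by blast
    have "length u - 1 = Suc (length u - 2)"
      using Suc Cons.prems(2) by simp
    then have "take (length (x # u) - 2) (x # u) = x # take (length u - 2) u"
      by simp
    then show ?thesis using IH Suc by (simp add: Let_def)
  qed
qed simp

lemma zigzag_snake_sides:
  assumes "Suc j < num_segments w"
  shows "let t = zigzag_snake w ! j in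
    (middle_path w ! j = W_edge t \<and> middle_path w ! Suc j = N_edge t) \<or>
    (middle_path w ! j = S_edge t \<and> middle_path w ! Suc j = E_edge t)"
proof -
  have len: "length (middle_dirs w) = num_segments w"
    by (simp add: middle_dirs_def num_segments_def)
  show ?thesis
    using steps_from_sides[OF distinct_adj_middle_dirs, of j w "(0, 0)"] assms
    unfolding zigzag_snake_def snake_def middle_path_def len .
qed

end

theory Submission
  imports Defs
begin

text \<open>
  Every step of a lattice path raises the level \<open>x + y\<close> by one, and the tiles of a snake graph have
  consecutive levels. So a path meets the line \<open>x + y = i + 1\<close> at one of only two vertices,
  the NW or the SE corner of the \<open>i\<close>-th tile. Recording \<open>True\<close> for NW turns paths into Boolean words,
  called profiles here. Two consecutive corners are joined by an edge of the graph
  iff the value does not drop when the next tile lies to the right, and does not rise when it lies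
  above. This gives a bijection between paths and the words satisfying these local conditions
  (\<open>lattice_paths_snake\<close>). Flipping a tile up turns one \<open>False\<close> into \<open>True\<close>, so the minimal path is
  the constant word \<open>False\<close>, the rank is the number of \<open>True\<close>s, and the rank function is the sum of
  \<open>q\<close> to the number of \<open>True\<close>s over all profiles (\<open>rank_function_snake\<close>). The bijection is used both
  for \<open>G\<^sub>w\<close> and for the zigzag graph.

  On \<open>G\<^sub>w\<close> a profile is increasing along every row and decreasing along every column. Group the
  profiles by their values at the \<open>d - 1\<close> corner tiles in which consecutive segments overlap. At a
  corner from a row to a column, the value \<open>False\<close> forces \<open>False\<close> on both segments; at a corner from
  a column to a row, the value \<open>True\<close> forces \<open>True\<close> on both. Call such a value exceptional, and the
  other one regular. Two neighbouring corners are never both exceptional. If one end of a segment is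
  exceptional, the segment is constant. If no end is, its values jump at a freely chosen place (at
  the first and the last segment, possibly nowhere), and the tiles strictly between the corners (at
  the first and the last segment: all tiles other than the corner) contribute \<open>[k\<^sub>i]\<^sub>q\<close>. An exceptional
  \<open>True\<close> accounts for \<open>k\<^sub>j + k\<^sub>j\<^sub>+\<^sub>1 - 1\<close> values \<open>True\<close>, those of the corner itself and of all tiles of
  both segments other than the adjacent corners; a regular \<open>True\<close> contributes the factor \<open>q\<close> of its
  own corner.

  These are the weights of the zigzag graph. The words of corner values are exactly the profiles of
  the zigzag graph, and a corner value is regular iff the corresponding path passes through the
  vertex of the middle path between its steps \<open>j\<close> and \<open>j + 1\<close>. Hence segment \<open>i\<close> jumps freely iff
  the path uses the \<open>i\<close>-th step of the middle path. The computation is a transfer matrix argument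
  along the segments, from the last one back to the first (\<open>rank_from_segment_word\<close>,
  \<open>rank_sum_segment_word\<close>); \<open>path_weight_eq_tail_weight\<close> identifies its outcome with the path weights.

  Since face weights enter through the topological notion of enclosure, it remains to see that the
  symmetric difference of a path and the minimal path encloses precisely the tiles with value
  \<open>True\<close> (\<open>encloses_iff\<close>). Both paths are graphs of functions of the level \<open>x + y\<close>. The strip
  strictly between them is open, bounded, and closed relative to the complement of the symmetric
  difference, so a component of the complement that meets it stays inside it. From a tile with value
  \<open>False\<close>, on the other hand, a ray of constant level escapes to the north-west without
  meeting either path.
\<close>

section \<open>Lattice paths as Boolean words\<close>

definition level :: "point \<Rightarrow> int" where "level p = fst p + snd p"

lemma level_move [simp]: "level (move x p) = level p + 1"
  by (cases x; cases p) (auto simp: level_def)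

lemma length_snake [simp]: "length (snake u) = Suc (length u)"
  by (simp add: snake_def)

lemma points_from_0 [simp]: "points_from p u ! 0 = p"
  by (cases u) auto

lemma points_from_Suc:
  "i < length u \<Longrightarrow> points_from p u ! Suc i = move (u ! i) (points_from p u ! i)"
proof (induction u arbitrary: p i)
  case (Cons x u)
  then show ?case by (cases i) auto
qed simp

lemma level_points_from: "i \<le> length u \<Longrightarrow> level (points_from p u ! i) = level p + int i"
  by (induction i) (auto simp: points_from_Suc)

lemma snake_0 [simp]: "snake u ! 0 = (0, 0)"
  by (simp add: snake_def)

lemma snake_Suc: "i < length u \<Longrightarrow> snake u ! Suc i = move (u ! i) (snake u ! i)"
  by (simp add: snake_def points_from_Suc)

lemma level_snake: "i \<le> length u \<Longrightarrow> level (snake u ! i) = int i"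
  by (simp add: snake_def level_points_from) (simp add: level_def)

lemma move_commute: "move La (move Lb p) = move Lb (move La p)"
  by (cases p) auto

lemma move_eq_iff [simp]: "move x p = move y p \<longleftrightarrow> x = y"
  by (cases x; cases y; cases p) auto

definition corner :: "point \<Rightarrow> bool \<Rightarrow> point" where
  "corner t b = move (if b then Lb else La) t"

lemma corner_eq_iff [simp]: "corner t b = corner t b' \<longleftrightarrow> b = b'"
  by (auto simp: corner_def)

lemma level_corner [simp]: "level (corner t b) = level t + 1"
  by (simp add: corner_def)

lemma edges_eq_corner:
  "S_edge t = (t, corner t False)" "W_edge t = (t, corner t True)"
  "E_edge t = (corner t False, move La (move Lb t))"
  "N_edge t = (corner t True, move La (move Lb t))"
  by (simp_all add: S_edge_def W_edge_def E_edge_def N_edge_def corner_def move_commute)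

text \<open>The constraint that a letter of the shape puts on the values at the two tiles it connects; it is
  justified by \<open>inner_edge_mem_iff\<close>.\<close>

fun compatible :: "letter \<Rightarrow> bool \<Rightarrow> bool \<Rightarrow> bool" where
  "compatible La x y \<longleftrightarrow> (x \<longrightarrow> y)"
| "compatible Lb x y \<longleftrightarrow> (y \<longrightarrow> x)"

definition profiles :: "letter list \<Rightarrow> bool list set" where
  "profiles u = {c. length c = Suc (length u) \<and>
     (\<forall>i<length u. compatible (u ! i) (c ! i) (c ! Suc i))}"

text \<open>The successive vertices of the path with profile \<open>c\<close>. The \<open>i\<close>-th vertex has level \<open>i\<close>, so with
  \<open>n\<close> tiles there are \<open>n + 2\<close> vertices, the first and the last of which are common to all paths.\<close>

definition vertex :: "letter list \<Rightarrow> bool list \<Rightarrow> nat \<Rightarrow> point" where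
  "vertex u c i =
     (if i = 0 then (0, 0)
      else if i \<le> Suc (length u) then corner (snake u ! (i - 1)) (c ! (i - 1))
      else move La (move Lb (snake u ! length u)))"

definition path_edge :: "letter list \<Rightarrow> bool list \<Rightarrow> nat \<Rightarrow> edge" where
  "path_edge u c i = (vertex u c i, vertex u c (Suc i))"

definition path_of :: "letter list \<Rightarrow> bool list \<Rightarrow> edge set" where
  "path_of u c = path_edge u c ` {..<length u + 2}"

lemma vertex_0 [simp]: "vertex u c 0 = (0, 0)"
  by (simp add: vertex_def)

lemma vertex_Suc: "i \<le> length u \<Longrightarrow> vertex u c (Suc i) = corner (snake u ! i) (c ! i)"
  by (simp add: vertex_def)

lemma vertex_end: "vertex u c (Suc (Suc (length u))) = move La (move Lb (snake u ! length u))"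
  by (simp add: vertex_def)

lemma level_vertex: "i \<le> length u + 2 \<Longrightarrow> level (vertex u c i) = int i"
proof (cases i)
  case (Suc k)
  assume "i \<le> length u + 2"
  then consider "k \<le> length u" | "k = Suc (length u)" using Suc by linarith
  then show ?thesis
    by cases (use Suc in \<open>simp_all add: vertex_Suc vertex_end level_snake\<close>)
qed (simp add: level_def)

lemma level_path_edge: "i < length u + 2 \<Longrightarrow> level (fst (path_edge u c i)) = int i"
  by (simp add: path_edge_def level_vertex)

text \<open>A path has exactly one edge starting at each level. Edge sets of paths can thus be compared level
  by level.\<close>

lemma path_edge_mem_path_of:
  assumes "i < length u + 2" "e \<in> path_of u c" "level (fst e) = int i"
  shows "e = path_edge u c i"
proof -
  obtain k where k: "k < length u + 2" "e = path_edge u c k"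
    using assms(2) by (auto simp: path_of_def)
  then have "k = i" using assms(3) by (simp add: level_path_edge)
  with k show ?thesis by simp
qed

lemma inj_on_path_edge: "inj_on (path_edge u c) {..<length u + 2}"
proof (rule inj_onI)
  fix i k assume *: "i \<in> {..<length u + 2}" "k \<in> {..<length u + 2}" "path_edge u c i = path_edge u c k"
  then have "int i = int k" using level_path_edge by (metis lessThan_iff)
  then show "i = k" by simp
qed

lemma path_edge_eq_of_path_of_eq:
  assumes "path_of u c = path_of u c'" "i < length u + 2"
  shows "path_edge u c i = path_edge u c' i"
proof -
  have "path_edge u c i \<in> path_of u c'" using assms unfolding path_of_def by blast
  then show ?thesis using path_edge_mem_path_of assms(2) level_path_edge by metis
qed

lemma inj_on_path_of: "inj_on (path_of u) (profiles u)"
proof (rule inj_onI)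
  fix c c' assume c: "c \<in> profiles u" "c' \<in> profiles u" and eq: "path_of u c = path_of u c'"
  show "c = c'"
  proof (rule nth_equalityI)
    show "length c = length c'" using c by (simp add: profiles_def)
    fix i assume "i < length c"
    then have i: "i \<le> length u" using c by (simp add: profiles_def)
    then have "path_edge u c i = path_edge u c' i"
      using path_edge_eq_of_path_of_eq[OF eq] by simp
    then have "corner (snake u ! i) (c ! i) = corner (snake u ! i) (c' ! i)"
      using i by (simp add: path_edge_def vertex_Suc)
    then show "c ! i = c' ! i" by simp
  qed
qed

lemma snake_edges_snake:
  "e \<in> snake_edges (snake u) \<longleftrightarrow> (\<exists>i\<le>length u. e \<in> {S_edge (snake u ! i), E_edge (snake u ! i),
      N_edge (snake u ! i), W_edge (snake u ! i)})"
  by (fastforce simp: snake_edges_def in_set_conv_nth less_Suc_eq_le)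

text \<open>The tiles of a snake graph have distinct levels, so an edge starting at level \<open>i\<close> either leaves the SW
  corner of tile \<open>i\<close> or arrives at the NE corner of tile \<open>i - 1\<close>.\<close>

lemma snake_edge_cases:
  assumes "e \<in> snake_edges (snake u)" "level (fst e) = int i"
  shows "(i \<le> length u \<and> fst e = snake u ! i \<and> (\<exists>b. snd e = corner (snake u ! i) b)) \<or>
    (\<exists>k\<le>length u. i = Suc k \<and> (\<exists>b. fst e = corner (snake u ! k) b) \<and>
        snd e = move La (move Lb (snake u ! k)))"
proof -
  obtain k where k: "k \<le> length u"
    and e: "e \<in> {S_edge (snake u ! k), E_edge (snake u ! k), N_edge (snake u ! k), W_edge (snake u ! k)}"
    using assms(1) by (auto simp: snake_edges_snake)
  let ?t = "snake u ! k"
  consider "e = S_edge ?t \<or> e = W_edge ?t" | "e = E_edge ?t \<or> e = N_edge ?t" using e by auto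
  then show ?thesis
  proof cases
    case 1
    then have "fst e = ?t" "\<exists>b. snd e = corner ?t b"
      by (auto simp: edges_eq_corner)
    moreover have "i = k" using \<open>fst e = ?t\<close> assms(2) k by (simp add: level_snake)
    ultimately show ?thesis using k by auto
  next
    case 2
    then have *: "snd e = move La (move Lb ?t)" "\<exists>b. fst e = corner ?t b"
      by (auto simp: edges_eq_corner)
    moreover have "i = Suc k" using *(2) assms(2) k by (auto simp: level_snake)
    ultimately show ?thesis using k by auto
  qed
qed

text \<open>One of the NW and SE corners of a tile is the SW corner of the next tile, and one of those of the
  next tile is the NE corner of the first. These coincidences decide which corners are joined.\<close>

lemma NE_eq_corner:
  assumes "i < length u"
  shows "move La (move Lb (snake u ! i)) = corner (snake u ! Suc i) b \<longleftrightarrow> b = (u ! i = La)"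
  using assms by (cases "u ! i"; cases b; cases "snake u ! i") (auto simp: snake_Suc corner_def)

lemma corner_eq_snake_Suc:
  assumes "i < length u"
  shows "corner (snake u ! i) b = snake u ! Suc i \<longleftrightarrow> b = (u ! i = Lb)"
  using assms by (cases "u ! i"; cases b) (auto simp: snake_Suc corner_def)

text \<open>Of the four conceivable edges between the corners of consecutive tiles, exactly one is missing: the
  one that avoids both the SW corner of the later tile and the NE corner of the earlier one.\<close>

lemma inner_edge_mem_iff:
  assumes "i < length u"
  shows "(corner (snake u ! i) b, corner (snake u ! Suc i) b') \<in> snake_edges (snake u) \<longleftrightarrow>
    compatible (u ! i) b b'" (is "?e \<in> _ \<longleftrightarrow> _")
proof
  assume mem: "?e \<in> snake_edges (snake u)"
  have "level (fst ?e) = int (Suc i)" using assms by (simp add: level_snake)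
  from snake_edge_cases[OF mem this]
  have "corner (snake u ! i) b = snake u ! Suc i \<or>
      move La (move Lb (snake u ! i)) = corner (snake u ! Suc i) b'"
    by auto
  then have "b = (u ! i = Lb) \<or> b' = (u ! i = La)"
    unfolding corner_eq_snake_Suc[OF assms] NE_eq_corner[OF assms] .
  then show "compatible (u ! i) b b'" by (cases "u ! i") auto
next
  assume "compatible (u ! i) b b'"
  then have "b = (u ! i = Lb) \<or> b' = (u ! i = La)" by (cases "u ! i") auto
  then show "?e \<in> snake_edges (snake u)"
  proof
    assume "b = (u ! i = Lb)"
    then have "corner (snake u ! i) b = snake u ! Suc i"
      by (rule corner_eq_snake_Suc[OF assms, THEN iffD2])
    then have "?e \<in> {S_edge (snake u ! Suc i), W_edge (snake u ! Suc i)}"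
      by (cases b') (auto simp: edges_eq_corner)
    then show ?thesis using assms unfolding snake_edges_snake
      by (intro exI[of _ "Suc i"] conjI) (simp, blast)
  next
    assume "b' = (u ! i = La)"
    then have "corner (snake u ! Suc i) b' = move La (move Lb (snake u ! i))"
      by (rule NE_eq_corner[OF assms, THEN iffD2, symmetric])
    then have "?e \<in> {E_edge (snake u ! i), N_edge (snake u ! i)}"
      by (cases b) (auto simp: edges_eq_corner)
    then show ?thesis using assms unfolding snake_edges_snake
      by (intro exI[of _ "i"] conjI) (simp, blast)
  qed
qed

lemma path_edge_mem_snake_edges:
  assumes "c \<in> profiles u" "i < length u + 2"
  shows "path_edge u c i \<in> snake_edges (snake u)"
proof -
  consider "i = 0" | k where "i = Suc k" "k < length u" | "i = Suc (length u)"
    using assms(2) by (cases i) (auto simp: less_Suc_eq)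
  then show ?thesis
  proof cases
    case 1
    then show ?thesis
      unfolding snake_edges_snake
      by (intro exI[of _ 0], cases "c ! 0") (auto simp: path_edge_def vertex_Suc edges_eq_corner)
  next
    case 2
    then show ?thesis using assms(1)
      by (simp add: path_edge_def vertex_Suc inner_edge_mem_iff profiles_def)
  next
    case 3
    then show ?thesis
      unfolding snake_edges_snake
      by (intro exI[of _ "length u"], cases "c ! length u")
         (auto simp: path_edge_def vertex_Suc vertex_end edges_eq_corner)
  qed
qed

lemma is_walk_iff_vertices:
  "is_walk E a es b \<longleftrightarrow> (\<exists>f. f 0 = a \<and> f (length es) = b \<and>
     (\<forall>i<length es. es ! i = (f i, f (Suc i)) \<and> es ! i \<in> E))"
proof (induction es arbitrary: a)
  case Nil
  then show ?case by (auto intro: exI[of _ "\<lambda>_. b"])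
next
  case (Cons e es)
  show ?case
  proof
    assume L: "is_walk E a (e # es) b"
    then obtain f where f: "f 0 = snd e" "f (length es) = b"
      "\<forall>i<length es. es ! i = (f i, f (Suc i)) \<and> es ! i \<in> E" using Cons.IH by auto
    define g where "g = case_nat a f"
    have "\<forall>i<length (e # es). (e # es) ! i = (g i, g (Suc i)) \<and> (e # es) ! i \<in> E"
    proof (intro allI impI)
      fix i assume "i < length (e # es)"
      then show "(e # es) ! i = (g i, g (Suc i)) \<and> (e # es) ! i \<in> E"
        using L f by (cases i) (auto simp: g_def)
    qed
    moreover have "g 0 = a" "g (length (e # es)) = b"
      by (simp_all add: g_def f)
    ultimately show "\<exists>f. f 0 = a \<and> f (length (e # es)) = b \<and>
       (\<forall>i<length (e # es). (e # es) ! i = (f i, f (Suc i)) \<and> (e # es) ! i \<in> E)"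
      by blast
  next
    assume "\<exists>f. f 0 = a \<and> f (length (e # es)) = b \<and>
       (\<forall>i<length (e # es). (e # es) ! i = (f i, f (Suc i)) \<and> (e # es) ! i \<in> E)"
    then obtain f where f: "f 0 = a" "f (Suc (length es)) = b"
      "\<And>i. i < Suc (length es) \<Longrightarrow> (e # es) ! i = (f i, f (Suc i))"
      "\<And>i. i < Suc (length es) \<Longrightarrow> (e # es) ! i \<in> E" by (metis length_Cons)
    have "is_walk E (f 1) es b"
      unfolding Cons.IH using f(2) f(3)[of "Suc _"] f(4)[of "Suc _"]
      by (intro exI[of _ "\<lambda>i. f (Suc i)"]) simp
    then show "is_walk E a (e # es) b" using f(1) f(3)[of 0] f(4)[of 0] by simp
  qed
qed

lemma level_snd_snake_edge: "e \<in> snake_edges ts \<Longrightarrow> level (snd e) = level (fst e) + 1"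
  by (auto simp: snake_edges_def edges_eq_corner simp del: move.simps)

lemma hd_snake [simp]: "hd (snake u) = (0, 0)"
  by (cases u) (simp_all add: snake_def)

lemma last_snake: "last (snake u) = snake u ! length u"
  by (subst last_conv_nth) (auto simp flip: length_0_conv)

text \<open>Profiles parametrize the lattice paths. Levels increase by one along a walk, which fixes its
  length and forces its \<open>i + 1\<close>-st vertex to be a corner of tile \<open>i\<close>; the values so obtained satisfy the
  local conditions by \<open>inner_edge_mem_iff\<close>.\<close>

lemma lattice_paths_snake: "lattice_paths (snake u) = path_of u ` profiles u"
proof (rule set_eqI)
  fix L
  let ?E = "snake_edges (snake u)" and ?end = "move La (move Lb (snake u ! length u))"
  show "L \<in> lattice_paths (snake u) \<longleftrightarrow> L \<in> path_of u ` profiles u"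
  proof
    assume "L \<in> path_of u ` profiles u"
    then obtain c where c: "c \<in> profiles u" "L = path_of u c" by blast
    let ?es = "map (path_edge u c) [0..<length u + 2]"
    have "is_walk ?E (0, 0) ?es ?end"
      unfolding is_walk_iff_vertices
      using path_edge_mem_snake_edges[OF c(1)] vertex_end[of u c]
      by (intro exI[of _ "vertex u c"]) (auto simp: path_edge_def simp del: upt_Suc)
    moreover have "set ?es = L" using c(2) by (simp add: path_of_def atLeast0LessThan del: upt_Suc)
    ultimately show "L \<in> lattice_paths (snake u)"
      unfolding lattice_paths_def last_snake hd_snake by blast
  next
    assume "L \<in> lattice_paths (snake u)"
    then obtain es f where L: "L = set es" and f: "f 0 = (0, 0)" "f (length es) = ?end"
      and es: "\<And>i. i < length es \<Longrightarrow> es ! i = (f i, f (Suc i)) \<and> es ! i \<in> ?E"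
      unfolding lattice_paths_def last_snake hd_snake is_walk_iff_vertices by auto
    have lev: "level (f i) = int i" if "i \<le> length es" for i
      using that
    proof (induction i)
      case (Suc i)
      then show ?case using es[of i] level_snd_snake_edge[of "es ! i"] by auto
    qed (simp add: f level_def)
    have len: "length es = length u + 2"
      using lev[of "length es"] f(2) by (simp add: level_snake)
    have "\<exists>b. f (Suc i) = corner (snake u ! i) b" if i: "i \<le> length u" for i
    proof -
      have e: "es ! i = (f i, f (Suc i))" "es ! i \<in> ?E"
        using es[of i, THEN conjunct1] es[of i, THEN conjunct2] i len by linarith+
      have "level (fst (es ! i)) = int i" using e lev i len by simp
      from snake_edge_cases[OF e(2) this] show ?thesis
        using e(1) NE_eq_corner i by auto
    qed
    then obtain g where g: "\<And>i. i \<le> length u \<Longrightarrow> f (Suc i) = corner (snake u ! i) (g i)"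
      by metis
    define c where "c = map g [0..<Suc (length u)]"
    have c_nth: "c ! i = g i" if "i \<le> length u" for i
      using that by (simp add: c_def del: upt_Suc)
    have f_vertex: "f i = vertex u c i" if le: "i \<le> length u + 2" for i
    proof -
      consider "i = 0" | k where "i = Suc k" "k \<le> length u" | "i = Suc (Suc (length u))"
        using le by (cases i) (auto simp: le_Suc_eq)
      then show ?thesis
        by cases (use f len in \<open>auto simp: g c_nth vertex_Suc vertex_end\<close>)
    qed
    have "c \<in> profiles u"
    proof -
      have "compatible (u ! i) (c ! i) (c ! Suc i)" if "i < length u" for i
        using es[of "Suc i", THEN conjunct1] es[of "Suc i", THEN conjunct2] that len
          g[of i] g[of "Suc i"]
        by (simp add: c_nth inner_edge_mem_iff)
      then show ?thesis by (simp add: profiles_def c_def)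
    qed
    moreover have "L = path_of u c"
    proof -
      have "es = map (path_edge u c) [0..<length u + 2]"
        by (rule nth_equalityI) (use es len f_vertex in \<open>auto simp: path_edge_def simp del: upt_Suc\<close>)
      then show ?thesis by (simp add: L path_of_def atLeast0LessThan del: upt_Suc)
    qed
    ultimately show "L \<in> path_of u ` profiles u" by blast
  qed
qed

section \<open>Flips and the rank\<close>

definition num_true :: "bool list \<Rightarrow> nat" where "num_true c = count_list c True"

lemma length_profile: "c \<in> profiles u \<Longrightarrow> length c = Suc (length u)"
  by (simp add: profiles_def)

lemma num_true_update: "i < length c \<Longrightarrow> \<not> c ! i \<Longrightarrow> num_true (c[i := True]) = Suc (num_true c)"
  unfolding num_true_def
proof (induction c arbitrary: i)
  case (Cons a c)
  then show ?case by (cases i) auto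
qed simp

text \<open>If both values at tile \<open>i\<close> are compatible with the neighbouring values, then the path has to enter
  the tile at its SW corner and leave it at its NE corner, so that it can be flipped there.\<close>

lemma path_covers_upd:
  assumes c: "c \<in> profiles u" and c': "c[i := True] \<in> profiles u" and i: "i \<le> length u" "\<not> c ! i"
  shows "(path_of u c, path_of u (c[i := True])) \<in> path_covers (snake u)"
proof -
  let ?t = "snake u ! i" and ?c = "c[i := True]"
  have len: "length c = Suc (length u)" using c by (rule length_profile)
  have comp: "\<And>k. k < length u \<Longrightarrow> compatible (u ! k) (c ! k) (c ! Suc k)"
    "\<And>k. k < length u \<Longrightarrow> compatible (u ! k) (?c ! k) (?c ! Suc k)"
    using c c' by (simp_all add: profiles_def)
  have SW: "vertex u c i = ?t"
  proof (cases i)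
    case (Suc k)
    have k: "k < length u" using Suc i by simp
    have "c ! k = (u ! k = Lb)"
      using comp[of k] Suc i k len by (cases "u ! k") auto
    then show ?thesis using corner_eq_snake_Suc[OF k] Suc k by (simp add: vertex_Suc)
  qed simp
  have NE: "vertex u c (Suc (Suc i)) = move La (move Lb ?t)"
  proof (cases "i = length u")
    case False
    then have k: "i < length u" using i by simp
    have "c ! Suc i = (u ! i = La)"
      using comp[of i] i k len by (cases "u ! i") auto
    from NE_eq_corner[OF k, THEN iffD2, OF this] k show ?thesis by (simp add: vertex_Suc)
  qed (simp add: vertex_end)
  have same: "vertex u ?c k = vertex u c k" if "k \<noteq> Suc i" for k
    using that len i by (cases k) (auto simp: vertex_def)
  have mid: "vertex u c (Suc i) = move La ?t" "vertex u ?c (Suc i) = move Lb ?t"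
    using i len by (simp_all add: vertex_Suc corner_def)
  have edges: "path_edge u c i = S_edge ?t" "path_edge u c (Suc i) = E_edge ?t"
    "path_edge u ?c i = W_edge ?t" "path_edge u ?c (Suc i) = N_edge ?t"
    using SW NE mid same[of i] same[of "Suc (Suc i)"]
    by (simp_all add: path_edge_def S_edge_def E_edge_def W_edge_def N_edge_def move_commute)
  have esame: "path_edge u ?c k = path_edge u c k" if "k \<noteq> i" "k \<noteq> Suc i" for k
    using that same by (simp add: path_edge_def)
  let ?I = "{..<length u + 2}"
  have I: "?I = insert i (insert (Suc i) (?I - {i, Suc i}))" using i by auto
  have "path_of u c - {S_edge ?t, E_edge ?t} = path_edge u c ` (?I - {i, Suc i})"
  proof -
    have "path_edge u c ` (?I - {i, Suc i}) = path_edge u c ` ?I - path_edge u c ` {i, Suc i}"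
      by (rule inj_on_image_set_diff[OF inj_on_path_edge]) (use i in auto)
    then show ?thesis by (simp add: path_of_def edges)
  qed
  also have "\<dots> = path_edge u ?c ` (?I - {i, Suc i})"
    by (rule image_cong) (auto simp: esame)
  finally have "path_of u ?c = (path_of u c - {S_edge ?t, E_edge ?t}) \<union> {W_edge ?t, N_edge ?t}"
    unfolding path_of_def by (subst I) (auto simp: edges)
  moreover have "{S_edge ?t, E_edge ?t} \<subseteq> path_of u c"
    unfolding path_of_def edges[symmetric] using i by auto
  moreover have "?t \<in> set (snake u)" using i by simp
  ultimately show ?thesis
    using c c' by (auto simp: path_covers_def lattice_paths_snake)
qed

lemma path_covers_imp_upd:
  assumes "(path_of u c, L) \<in> path_covers (snake u)" and c: "c \<in> profiles u"
  shows "\<exists>i\<le>length u. \<not> c ! i \<and> c[i := True] \<in> profiles u \<and> L = path_of u (c[i := True])"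
proof -
  from assms obtain c' t where c': "c' \<in> profiles u" "L = path_of u c'"
    and t: "t \<in> set (snake u)" and sub: "{S_edge t, E_edge t} \<subseteq> path_of u c"
    and L: "L = (path_of u c - {S_edge t, E_edge t}) \<union> {W_edge t, N_edge t}"
    by (auto simp: path_covers_def lattice_paths_snake)
  obtain i where i: "i \<le> length u" "t = snake u ! i"
    using t by (auto simp: in_set_conv_nth less_Suc_eq_le)
  have lev: "level (fst (S_edge t)) = int i" "level (fst (W_edge t)) = int i"
    "level (fst (E_edge t)) = int (Suc i)" "level (fst (N_edge t)) = int (Suc i)"
    using i by (simp_all add: S_edge_def E_edge_def W_edge_def N_edge_def level_snake)
  have e: "S_edge t = path_edge u c i" "E_edge t = path_edge u c (Suc i)"
    "W_edge t = path_edge u c' i" "N_edge t = path_edge u c' (Suc i)"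
    using path_edge_mem_path_of lev sub L c' i by auto
  have len: "length c = Suc (length u)" "length c' = Suc (length u)"
    using c c' length_profile by auto
  have ci: "\<not> c ! i" "c' ! i"
    using e(1,3) i by (auto simp: path_edge_def S_edge_def W_edge_def vertex_Suc corner_def split: if_splits)
  have "c' ! k = c ! k" if k: "k \<le> length u" "k \<noteq> i" for k
  proof -
    have "vertex u c' (Suc k) = vertex u c (Suc k)"
    proof (cases "k = Suc i")
      case True
      then show ?thesis using e by (simp add: path_edge_def edges_eq_corner)
    next
      case False
      have *: "level (fst (path_edge u c' k)) = int k" using level_path_edge k by simp
      have "path_edge u c' k \<in> path_of u c'" using k by (auto simp: path_of_def)
      then have "path_edge u c' k \<in> path_of u c"
        using L c' lev * False k by auto
      then have "path_edge u c' k = path_edge u c k"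
        using path_edge_mem_path_of * k by simp
      then show ?thesis by (simp add: path_edge_def)
    qed
    then show ?thesis using k by (simp add: vertex_Suc)
  qed
  then have "c' = c[i := True]"
    using ci len i by (intro nth_equalityI) (auto simp: nth_list_update less_Suc_eq_le)
  then show ?thesis using i ci c' by blast
qed

text \<open>A cover adds exactly one \<open>True\<close>, so the length of a saturated chain is determined by its ends.\<close>

lemma path_covers_pow_size:
  assumes "(path_of u c, L) \<in> path_covers (snake u) ^^ r" "c \<in> profiles u"
  shows "\<exists>c'\<in>profiles u. L = path_of u c' \<and> num_true c' = num_true c + r"
  using assms
proof (induction r arbitrary: L)
  case (Suc r)
  then obtain L' where L': "(path_of u c, L') \<in> path_covers (snake u) ^^ r"
    "(L', L) \<in> path_covers (snake u)" by auto
  then obtain c' where c': "c' \<in> profiles u" "L' = path_of u c'" "num_true c' = num_true c + r"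
    using Suc by blast
  from path_covers_imp_upd[OF _ c'(1)] L'(2) c'(2) obtain i where
    i: "i \<le> length u" "\<not> c' ! i" "c'[i := True] \<in> profiles u" "L = path_of u (c'[i := True])" by blast
  then show ?case using c' num_true_update[of i c'] length_profile[OF c'(1)] by force
qed auto

definition bottom_profile :: "letter list \<Rightarrow> bool list" where
  "bottom_profile u = replicate (Suc (length u)) False"

lemma bottom_profile_in: "bottom_profile u \<in> profiles u"
proof -
  have "compatible y False False" for y by (cases y) auto
  then show ?thesis by (simp add: profiles_def bottom_profile_def del: replicate_Suc)
qed

lemma num_true_eq_0: "c \<in> profiles u \<Longrightarrow> num_true c = 0 \<longleftrightarrow> c = bottom_profile u"
proof -
  assume c: "c \<in> profiles u"
  have "num_true c = 0 \<longleftrightarrow> (\<forall>x\<in>set c. x = False)"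
    by (auto simp: num_true_def count_list_0_iff)
  also have "\<dots> \<longleftrightarrow> c = replicate (length c) False"
    by (induction c) auto
  finally show ?thesis using length_profile[OF c] by (simp add: bottom_profile_def)
qed

text \<open>Some \<open>True\<close> can always be lowered. The conditions say that a \<open>True\<close> on the higher of two
  adjacent tiles, measured by \<open>y - x\<close>, forces a \<open>True\<close> on the lower one; so a \<open>True\<close> on a tile of
  maximal \<open>y - x\<close> can be removed.\<close>

lemma ex_lower_profile:
  assumes c: "c \<in> profiles u" and ne: "c \<noteq> bottom_profile u"
  shows "\<exists>i\<le>length u. c ! i \<and> c[i := False] \<in> profiles u"
proof -
  define h where "h i = snd (snake u ! i) - fst (snake u ! i)" for i
  have len: "length c = Suc (length u)" using c by (rule length_profile)
  let ?I = "{i. i \<le> length u \<and> c ! i}"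
  have "num_true c \<noteq> 0" using num_true_eq_0[OF c] ne by simp
  then have "True \<in> set c" by (simp add: num_true_def count_list_0_iff)
  then have "?I \<noteq> {}" using len by (auto simp: in_set_conv_nth less_Suc_eq_le)
  moreover have "finite ?I" by (rule finite_subset[of _ "{..length u}"]) auto
  ultimately have max: "Max (h ` ?I) \<in> h ` ?I" "\<forall>j\<in>?I. h j \<le> Max (h ` ?I)"
    by (intro Max_in, simp_all)
  then obtain i where "i \<in> ?I" "Max (h ` ?I) = h i"
    by blast
  with max have i: "i \<in> ?I" "\<forall>j\<in>?I. h j \<le> h i"
    by simp_all
  have step: "h (Suc k) = (if u ! k = La then h k - 1 else h k + 1)" if "k < length u" for k
    using that by (cases "u ! k"; cases "snake u ! k") (auto simp: h_def snake_Suc)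
  have "compatible (u ! k) (c[i := False] ! k) (c[i := False] ! Suc k)" if k: "k < length u" for k
  proof -
    have "compatible (u ! k) (c ! k) (c ! Suc k)" using c k by (simp add: profiles_def)
    moreover have "c ! k \<Longrightarrow> h k \<le> h i" "c ! Suc k \<Longrightarrow> h (Suc k) \<le> h i"
      using i k by auto
    ultimately show ?thesis using i step[OF k] k len
      by (cases "u ! k"; cases "k = i"; cases "Suc k = i") (auto simp: nth_list_update)
  qed
  then have "c[i := False] \<in> profiles u" using len by (simp add: profiles_def)
  then show ?thesis using i by blast
qed

lemma bottom_reaches:
  assumes "c \<in> profiles u"
  shows "(path_of u (bottom_profile u), path_of u c) \<in> path_covers (snake u) ^^ num_true c"
  using assms
proof (induction "num_true c" arbitrary: c)
  case 0
  then have "c = bottom_profile u" using num_true_eq_0[OF 0(2)] by simp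
  then show ?case using 0(1)[symmetric] by simp
next
  case (Suc r)
  have "c \<noteq> bottom_profile u" using num_true_eq_0[OF Suc(3)] Suc(2) by simp
  then obtain i where i: "i \<le> length u" "c ! i" "c[i := False] \<in> profiles u"
    using ex_lower_profile[OF Suc(3)] by blast
  let ?c = "c[i := False]"
  have len: "length c = Suc (length u)" using Suc.prems by (rule length_profile)
  have restore: "?c[i := True] = c" using i by (metis list_update_id list_update_overwrite)
  have sz: "num_true c = Suc (num_true ?c)"
    using num_true_update[of i ?c] restore i len by simp
  have "(path_of u ?c, path_of u (?c[i := True])) \<in> path_covers (snake u)"
    by (rule path_covers_upd) (use i Suc.prems restore len in auto)
  moreover have "(path_of u (bottom_profile u), path_of u ?c) \<in> path_covers (snake u) ^^ num_true ?c"
    using Suc i sz by auto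
  ultimately show ?case unfolding sz restore by auto
qed

lemma min_path_snake: "min_path (snake u) = path_of u (bottom_profile u)"
  unfolding min_path_def
proof (rule the_equality)
  show "path_of u (bottom_profile u) \<in> lattice_paths (snake u) \<and>
    (\<forall>L'\<in>lattice_paths (snake u). (path_of u (bottom_profile u), L') \<in> (path_covers (snake u))\<^sup>*)"
    using bottom_profile_in bottom_reaches by (auto simp: lattice_paths_snake intro: relpow_imp_rtrancl)
next
  fix L assume L: "L \<in> lattice_paths (snake u) \<and>
    (\<forall>L'\<in>lattice_paths (snake u). (L, L') \<in> (path_covers (snake u))\<^sup>*)"
  then obtain c where c: "c \<in> profiles u" "L = path_of u c" by (auto simp: lattice_paths_snake)
  have "(L, path_of u (bottom_profile u)) \<in> (path_covers (snake u))\<^sup>*"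
    using L bottom_profile_in by (auto simp: lattice_paths_snake)
  then obtain r where "(path_of u c, path_of u (bottom_profile u)) \<in> path_covers (snake u) ^^ r"
    using c by (auto simp: rtrancl_power)
  from path_covers_pow_size[OF this c(1)] obtain c' where c': "c' \<in> profiles u"
    "path_of u (bottom_profile u) = path_of u c'" "num_true c' = num_true c + r" by blast
  then have "c' = bottom_profile u" using inj_on_path_of bottom_profile_in by (metis inj_onD)
  then have "num_true c = 0" using c' num_true_eq_0[OF c'(1)] by simp
  then show "L = path_of u (bottom_profile u)" using c num_true_eq_0[OF c(1)] by simp
qed

lemma path_rank_snake: 
  assumes c: "c \<in> profiles u"
  shows "path_rank (snake u) (path_of u c) = num_true c"
  unfolding path_rank_def min_path_snake
proof (rule the_equality)
  show "(path_of u (bottom_profile u), path_of u c) \<in> path_covers (snake u) ^^ num_true c"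
    by (rule bottom_reaches[OF c])
next
  fix r assume "(path_of u (bottom_profile u), path_of u c) \<in> path_covers (snake u) ^^ r"
  from path_covers_pow_size[OF this bottom_profile_in] obtain c' where
    "c' \<in> profiles u" "path_of u c = path_of u c'" "num_true c' = num_true (bottom_profile u) + r"
    by blast
  moreover from this have "c' = c" using inj_on_path_of c by (metis inj_onD)
  moreover have "num_true (bottom_profile u) = 0" using num_true_eq_0[OF bottom_profile_in] by simp
  ultimately show "r = num_true c" by simp
qed

lemma finite_profiles [simp]: "finite (profiles u)"
  by (rule finite_subset[OF _ finite_lists_length_eq[of UNIV "Suc (length u)"]])
     (auto simp: profiles_def)

lemma rank_function_snake: "rank_function (snake u) = (\<Sum>c\<in>profiles u. qv ^ num_true c)"
proof -
  have num: "num_of_rank (snake u) i = card {c \<in> profiles u. num_true c = i}" for i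
  proof -
    have "{L \<in> lattice_paths (snake u). path_rank (snake u) L = i} =
      path_of u ` {c \<in> profiles u. num_true c = i}"
      by (auto simp: lattice_paths_snake path_rank_snake)
    moreover have "inj_on (path_of u) {c \<in> profiles u. num_true c = i}"
      by (rule inj_on_subset[OF inj_on_path_of]) auto
    ultimately show ?thesis by (simp add: num_of_rank_def card_image)
  qed
  have "{i. num_of_rank (snake u) i \<noteq> 0} = num_true ` profiles u"
    by (auto simp: num card_eq_0_iff)
  then have "rank_function (snake u) =
      (\<Sum>i\<in>num_true ` profiles u. \<Sum>c\<in>{c \<in> profiles u. num_true c = i}. qv ^ num_true c)"
    by (simp add: rank_function_def num)
  also have "\<dots> = (\<Sum>c\<in>profiles u. qv ^ num_true c)"
    by (rule sum.image_gen[symmetric]) simp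
  finally show ?thesis .
qed

section \<open>Enclosed tiles\<close>

text \<open>The \<open>x\<close>-coordinate of the point at which a path crosses the line \<open>x + y = s\<close>. Writing the
  piecewise linear interpolation as a sum of truncated ramps makes its continuity evident; for \<open>s\<close>
  outside the range of the path it is constant.\<close>

definition xpos :: "letter list \<Rightarrow> bool list \<Rightarrow> real \<Rightarrow> real" where
  "xpos u c s = (\<Sum>i<length u + 2.
     real_of_int (fst (vertex u c (Suc i)) - fst (vertex u c i)) * max 0 (min 1 (s - real i)))"

lemma continuous_on_xpos [continuous_intros]:
  "continuous_on A f \<Longrightarrow> continuous_on A (\<lambda>p. xpos u c (f p))"
  unfolding xpos_def by (intro continuous_intros)

text \<open>For \<open>s\<close> between \<open>k\<close> and \<open>k + 1\<close> the ramps before the \<open>k\<close>-th are saturated and those after it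
  vanish, so the sum telescopes up to one linear term.\<close>

lemma interpolation:
  fixes f :: "nat \<Rightarrow> real"
  assumes "real k \<le> s" "s \<le> real k + 1" "k < N"
  shows "(\<Sum>i<N. (f (Suc i) - f i) * max 0 (min 1 (s - real i))) = f k - f 0 + (f (Suc k) - f k) * (s - real k)"
  using assms(3)
proof (induction N)
  case (Suc N)
  show ?case
  proof (cases "k < N")
    case True
    then have "max 0 (min 1 (s - real N)) = 0" using assms(2) by simp
    then show ?thesis using Suc.IH[OF True] by simp
  next
    case False
    then have N: "N = k" using Suc.prems by simp
    have "(\<Sum>i<k. (f (Suc i) - f i) * max 0 (min 1 (s - real i))) = (\<Sum>i<k. f (Suc i) - f i)"
      by (intro sum.cong) (use assms(1) in auto)
    also have "\<dots> = f k - f 0" by (rule sum_lessThan_telescope)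
    finally show ?thesis using assms(1,2) N by simp
  qed
qed simp

lemma xpos_eq:
  assumes "k < length u + 2" "real k \<le> s" "s \<le> real k + 1"
  shows "xpos u c s = real_of_int (fst (vertex u c k)) +
     real_of_int (fst (vertex u c (Suc k)) - fst (vertex u c k)) * (s - real k)"
  using interpolation[OF assms(2,3,1), of "\<lambda>i. real_of_int (fst (vertex u c i))"]
  by (simp add: xpos_def)

lemma xpos_before: "s \<le> 0 \<Longrightarrow> xpos u c s = 0"
  unfolding xpos_def by (intro sum.neutral) auto

lemma xpos_after:
  assumes "s \<ge> real (length u + 2)"
  shows "xpos u c s = real_of_int (fst (vertex u c (length u + 2)))"
proof -
  have "xpos u c s = (\<Sum>i<length u + 2. real_of_int (fst (vertex u c (Suc i))) - real_of_int (fst (vertex u c i)))"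
    unfolding xpos_def by (intro sum.cong) (use assms in auto)
  also have "\<dots> = real_of_int (fst (vertex u c (length u + 2)))"
    by (subst sum_lessThan_telescope) simp
  finally show ?thesis .
qed

lemma fst_vertex_step:
  assumes "c \<in> profiles u" "i < length u + 2"
  shows "fst (vertex u c (Suc i)) - fst (vertex u c i) \<in> {0, 1}"
proof -
  have "path_edge u c i \<in> snake_edges (snake u)"
    by (rule path_edge_mem_snake_edges[OF assms])
  then show ?thesis
    by (auto simp: path_edge_def snake_edges_def S_edge_def W_edge_def E_edge_def N_edge_def)
qed

lemma xpos_bounds:
  assumes "c \<in> profiles u"
  shows "0 \<le> xpos u c s" "xpos u c s \<le> real (length u + 2)"
proof -
  let ?D = "\<lambda>i. real_of_int (fst (vertex u c (Suc i)) - fst (vertex u c i)) * max 0 (min 1 (s - real i))"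
  have D: "0 \<le> ?D i \<and> ?D i \<le> 1" if "i < length u + 2" for i
  proof -
    have "real_of_int (fst (vertex u c (Suc i)) - fst (vertex u c i)) \<in> {0, 1}"
      using fst_vertex_step[OF assms that] by (auto simp del: of_int_diff)
    then show ?thesis by auto
  qed
  show "0 \<le> xpos u c s" unfolding xpos_def by (rule sum_nonneg) (use D in auto)
  have "xpos u c s \<le> (\<Sum>i<length u + 2. 1)" unfolding xpos_def by (rule sum_mono) (use D in auto)
  then show "xpos u c s \<le> real (length u + 2)" by simp
qed

text \<open>The edges of a path, as subsets of the plane, are the pieces of the graph of \<open>xpos\<close> over unit
  intervals of levels.\<close>

lemma mem_path_edge_segment:
  assumes i: "i < length u + 2"
  shows "p \<in> closed_segment (real_point (vertex u c i)) (real_point (vertex u c (Suc i))) \<longleftrightarrow>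
    real i \<le> fst p + snd p \<and> fst p + snd p \<le> real i + 1 \<and> fst p = xpos u c (fst p + snd p)"
proof -
  define a where "a = real_of_int (fst (vertex u c i))"
  define b where "b = real_of_int (fst (vertex u c (Suc i)))"
  have lev: "fst (vertex u c k) + snd (vertex u c k) = int k" if "k \<le> length u + 2" for k
    using level_vertex[OF that] by (simp add: level_def)
  have "real_of_int (snd (vertex u c i)) = real i - a"
    using lev[of i] i unfolding a_def by linarith
  moreover have "real_of_int (snd (vertex u c (Suc i))) = real i + 1 - b"
    using lev[of "Suc i"] i unfolding b_def by linarith
  ultimately have ends: "real_point (vertex u c i) = (a, real i - a)"
    "real_point (vertex u c (Suc i)) = (b, real i + 1 - b)"
    by (simp_all add: real_point_def a_def b_def)
  have x: "xpos u c s = a + (b - a) * (s - real i)" if "real i \<le> s" "s \<le> real i + 1" for s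
    using xpos_eq[OF i that] by (simp add: a_def b_def)
  show ?thesis
  proof
    assume "p \<in> closed_segment (real_point (vertex u c i)) (real_point (vertex u c (Suc i)))"
    then obtain t where t: "0 \<le> t" "t \<le> 1" "p = (1 - t) *\<^sub>R (a, real i - a) + t *\<^sub>R (b, real i + 1 - b)"
      unfolding ends in_segment by auto
    then have "fst p = a + (b - a) * t" "snd p = (1 - t) * (real i - a) + t * (real i + 1 - b)"
      by (auto simp: algebra_simps)
    moreover from this have "fst p + snd p = real i + t" by (simp add: algebra_simps)
    ultimately show "real i \<le> fst p + snd p \<and> fst p + snd p \<le> real i + 1 \<and> fst p = xpos u c (fst p + snd p)"
      using t x[of "real i + t"] by auto
  next
    assume *: "real i \<le> fst p + snd p \<and> fst p + snd p \<le> real i + 1 \<and> fst p = xpos u c (fst p + snd p)"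
    define t where "t = fst p + snd p - real i"
    have t: "0 \<le> t" "t \<le> 1" using * by (auto simp: t_def)
    have "xpos u c (fst p + snd p) = a + (b - a) * t"
      unfolding t_def by (rule x) (use * in auto)
    then have f: "fst p = a + (b - a) * t" using * by linarith
    then have "snd p = real i + t - (a + (b - a) * t)" unfolding t_def by linarith
    with f have "p = (1 - t) *\<^sub>R (a, real i - a) + t *\<^sub>R (b, real i + 1 - b)"
      by (simp add: prod_eq_iff algebra_simps)
    then show "p \<in> closed_segment (real_point (vertex u c i)) (real_point (vertex u c (Suc i)))"
      unfolding ends in_segment using t by blast
  qed
qed

definition sym_diff_region :: "letter list \<Rightarrow> bool list \<Rightarrow> bool list \<Rightarrow> (real \<times> real) set" where
  "sym_diff_region u c e = edges_region ((path_of u c - path_of u e) \<union> (path_of u e - path_of u c))"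

definition differing_levels :: "letter list \<Rightarrow> bool list \<Rightarrow> bool list \<Rightarrow> nat set" where
  "differing_levels u c e = {i. i < length u + 2 \<and> path_edge u c i \<noteq> path_edge u e i}"

lemma path_of_diff: "path_of u c - path_of u e = path_edge u c ` differing_levels u c e"
proof -
  have "path_edge u c i \<in> path_of u e \<longleftrightarrow> path_edge u c i = path_edge u e i" if "i < length u + 2" for i
  proof
    assume "path_edge u c i \<in> path_of u e"
    then show "path_edge u c i = path_edge u e i"
      by (rule path_edge_mem_path_of[OF that _ level_path_edge[OF that]])
  qed (use that in \<open>auto simp: path_of_def\<close>)
  then show ?thesis by (auto simp: path_of_def[of u c] differing_levels_def)
qed

lemma differing_levels_commute: "differing_levels u c e = differing_levels u e c"
  by (auto simp: differing_levels_def)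

lemma mem_sym_diff_region:
  "p \<in> sym_diff_region u c e \<longleftrightarrow> (\<exists>i\<in>differing_levels u c e.
     real i \<le> fst p + snd p \<and> fst p + snd p \<le> real i + 1 \<and>
     (fst p = xpos u c (fst p + snd p) \<or> fst p = xpos u e (fst p + snd p)))"
proof -
  let ?D = "differing_levels u c e"
  have "p \<in> sym_diff_region u c e \<longleftrightarrow> (\<exists>i\<in>?D.
     p \<in> closed_segment (real_point (vertex u c i)) (real_point (vertex u c (Suc i))) \<or>
     p \<in> closed_segment (real_point (vertex u e i)) (real_point (vertex u e (Suc i))))"
    unfolding sym_diff_region_def edges_region_def path_of_diff differing_levels_commute[of u e c]
    by (auto simp: path_edge_def)
  also have "\<dots> \<longleftrightarrow> (\<exists>i\<in>?D.
     real i \<le> fst p + snd p \<and> fst p + snd p \<le> real i + 1 \<and>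
     (fst p = xpos u c (fst p + snd p) \<or> fst p = xpos u e (fst p + snd p)))"
    by (intro bex_cong refl) (auto simp: mem_path_edge_segment differing_levels_def)
  finally show ?thesis .
qed

lemma xpos_eq_off_differing_levels:
  assumes "s \<notin> (\<Union>i\<in>differing_levels u c e. {real i..real i + 1})"
  shows "xpos u c s = xpos u e s"
proof -
  consider "s \<le> 0" | "s \<ge> real (length u + 2)" | "0 < s" "s < real (length u + 2)" by linarith
  then show ?thesis
  proof cases
    case 3
    define i where "i = nat \<lfloor>s\<rfloor>"
    have i: "real i \<le> s" "s \<le> real i + 1" using 3 by (simp_all add: i_def)
    then have "i < length u + 2" using 3 by linarith
    moreover from this have "path_edge u c i = path_edge u e i"
      using assms i by (auto simp: differing_levels_def)
    ultimately show ?thesis using i by (simp add: xpos_eq path_edge_def)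
  qed (simp_all add: xpos_before xpos_after vertex_end)
qed

definition strip :: "letter list \<Rightarrow> bool list \<Rightarrow> bool list \<Rightarrow> (real \<times> real) set" where
  "strip u c e = {p. xpos u c (fst p + snd p) < fst p \<and> fst p < xpos u e (fst p + snd p)}"

lemma open_strip: "open (strip u c e)"
  unfolding strip_def
  by (intro open_Collect_conj open_Collect_less continuous_intros)

text \<open>The strip between two paths is closed in the complement of their symmetric difference. A
  boundary point of the strip lies on one of the paths. If it is not on the symmetric difference, the paths
  agree at all levels around it, so that the strip is empty nearby.\<close>

lemma closure_strip:
  assumes "p \<in> closure (strip u c e)" "p \<notin> sym_diff_region u c e"
  shows "p \<in> strip u c e"
proof (rule ccontr)
  assume not: "p \<notin> strip u c e"
  let ?B = "\<Union>i\<in>differing_levels u c e. {real i..real i + 1}"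
  let ?s = "\<lambda>p::real\<times>real. fst p + snd p"
  have "closed {p. xpos u c (?s p) \<le> fst p \<and> fst p \<le> xpos u e (?s p)}"
    by (intro closed_Collect_conj closed_Collect_le continuous_intros)
  moreover have "strip u c e \<subseteq> {p. xpos u c (?s p) \<le> fst p \<and> fst p \<le> xpos u e (?s p)}"
    by (auto simp: strip_def)
  ultimately have "closure (strip u c e) \<subseteq> {p. xpos u c (?s p) \<le> fst p \<and> fst p \<le> xpos u e (?s p)}"
    by (rule closure_minimal[rotated])
  then have "fst p = xpos u c (?s p) \<or> fst p = xpos u e (?s p)"
    using assms(1) not by (auto simp: strip_def)
  then have p: "?s p \<notin> ?B" using assms(2) by (auto simp: mem_sym_diff_region)
  have "finite (differing_levels u c e)"
    by (rule finite_subset[of _ "{..<length u + 2}"]) (auto simp: differing_levels_def)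
  then have "closed ?B" by (rule closed_UN) auto
  moreover have "continuous_on UNIV ?s" by (intro continuous_intros)
  ultimately have "open (?s -` (- ?B))" by (intro open_vimage open_Compl)
  moreover have "?s -` (- ?B) \<inter> strip u c e = {}"
  proof -
    have "q \<notin> strip u c e" if "?s q \<notin> ?B" for q
      using xpos_eq_off_differing_levels[OF that] by (simp add: strip_def)
    then show ?thesis by blast
  qed
  ultimately have "?s -` (- ?B) \<inter> closure (strip u c e) = {}"
    by (simp add: open_Int_closure_eq_empty)
  then show False using assms(1) p by auto
qed

lemma bounded_strip:
  assumes "c \<in> profiles u" "e \<in> profiles u"
  shows "bounded (strip u c e)"
proof (rule bounded_subset[OF bounded_cbox])
  let ?N = "real (length u + 2)"
  show "strip u c e \<subseteq> cbox (0, - ?N) (?N, ?N)"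
  proof
    fix p assume p: "p \<in> strip u c e"
    have "fst p + snd p \<in> (\<Union>i\<in>differing_levels u c e. {real i..real i + 1})"
    proof (rule ccontr)
      assume "\<not> ?thesis"
      from xpos_eq_off_differing_levels[OF this] show False using p by (auto simp: strip_def)
    qed
    then obtain i where "i < length u + 2" "real i \<le> fst p + snd p" "fst p + snd p \<le> real i + 1"
      by (auto simp: differing_levels_def)
    moreover from this have "real i + 1 \<le> ?N" by linarith
    moreover have "0 \<le> fst p" "fst p \<le> ?N"
      using p xpos_bounds[OF assms(1), of "fst p + snd p"] xpos_bounds[OF assms(2), of "fst p + snd p"]
      by (auto simp: strip_def)
    ultimately show "p \<in> cbox (0, - ?N) (?N, ?N)"
      by (cases p) (simp add: cbox_prod)
  qed
qed

text \<open>In the complement of the symmetric difference the strip is open and closed, so it contains every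
  component that it meets; and it is bounded.\<close>

lemma strip_subset_inside:
  assumes "c \<in> profiles u" "e \<in> profiles u"
  shows "strip u c e \<subseteq> inside (sym_diff_region u c e)"
proof
  fix p assume p: "p \<in> strip u c e"
  let ?R = "sym_diff_region u c e" and ?W = "strip u c e"
  let ?C = "connected_component_set (- ?R) p"
  have pR: "p \<notin> ?R" using p by (auto simp: mem_sym_diff_region strip_def)
  have "openin (top_of_set ?C) (?C \<inter> ?W)" by (rule openin_open_Int[OF open_strip])
  moreover have "?C \<inter> ?W = ?C \<inter> closure ?W"
    using closure_strip closure_subset connected_component_subset by blast
  then have "closedin (top_of_set ?C) (?C \<inter> ?W)" by (simp add: closedin_closed_Int)
  moreover have "p \<in> ?C \<inter> ?W" using p pR by (simp add: connected_component_refl_eq)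
  moreover have "connected ?C" by simp
  ultimately have "?C \<inter> ?W = ?C" unfolding connected_clopen by blast
  then have "bounded ?C" using bounded_strip[OF assms] bounded_subset by blast
  then show "p \<in> inside ?R" using pR by (simp add: inside_def)
qed

text \<open>The minimal path passes through the SE corner of every tile and stays to the right of its
  interior. A path through the NW corner stays to the left of the interior, so the tile is in the strip.
  A path through the SE corner leaves open the way out to the north-west.\<close>

lemma encloses_iff:
  assumes c: "c \<in> profiles u" and j: "j \<le> length u"
  shows "encloses ((path_of u c - path_of u (bottom_profile u)) \<union>
      (path_of u (bottom_profile u) - path_of u c)) (snake u ! j) \<longleftrightarrow> c ! j"
proof -
  let ?e = "bottom_profile u"
  let ?R = "sym_diff_region u c ?e"
  have e: "?e \<in> profiles u" by (rule bottom_profile_in)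
  have ej: "\<not> ?e ! j" using j by (simp add: bottom_profile_def del: replicate_Suc)
  obtain x y where t: "snake u ! j = (x, y)" by fastforce
  define a b where "a = real_of_int x" and "b = real_of_int y"
  have ab: "a + b = real j"
  proof -
    have "x + y = int j" using level_snake[OF j] t by (simp add: level_def)
    then show ?thesis unfolding a_def b_def by linarith
  qed
  have box: "box (real_point (snake u ! j)) (real_point (move La (move Lb (snake u ! j)))) =
      {p. a < fst p \<and> fst p < a + 1 \<and> b < snd p \<and> snd p < b + 1}"
    by (auto simp: t real_point_def a_def b_def box_prod)
  have X: "real_of_int (fst (vertex u d (Suc j))) = (if d ! j then a else a + 1)" for d
    using j t by (auto simp: vertex_Suc corner_def a_def)
  have left: "real_of_int (fst (vertex u d (Suc j))) - real_of_int (fst (vertex u d j)) \<in> {0, 1}"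
    if "d \<in> profiles u" for d
    using fst_vertex_step[OF that, of j] j by auto
  have right: "real_of_int (fst (vertex u d (Suc (Suc j)))) - real_of_int (fst (vertex u d (Suc j))) \<in> {0, 1}"
    if "d \<in> profiles u" for d
    using fst_vertex_step[OF that, of "Suc j"] j by auto
  show ?thesis
  proof
    assume enc: "encloses ((path_of u c - path_of u ?e) \<union> (path_of u ?e - path_of u c)) (snake u ! j)"
    show "c ! j"
    proof (rule ccontr)
      assume cj: "\<not> c ! j"
      \<comment> \<open>A point of the tile off its NW-SE diagonal, so that the ray through it runs between vertices:\<close>
      \<comment> \<open>at its level \<open>j + 3/2\<close> both paths have left the SE corner and are at \<open>x \<ge> a + 1\<close>.\<close>
      let ?p = "(a + 3/4, b + 3/4)"
      have "?p \<in> box (real_point (snake u ! j)) (real_point (move La (move Lb (snake u ! j))))"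
        unfolding box by simp
      then have "?p \<in> inside ?R" using enc by (auto simp: encloses_def sym_diff_region_def)
      then have bd: "bounded (connected_component_set (- ?R) ?p)" by (simp add: inside_def)
      define Y where "Y = {p :: real \<times> real. fst p + snd p = real j + 3/2 \<and> fst p < a + 1}"
      have "convex Y"
      proof (rule convexI)
        fix p q :: "real \<times> real" and v w :: real
        assume "p \<in> Y" "q \<in> Y" and vw: "0 \<le> v" "0 \<le> w" "v + w = 1"
        then have p: "fst p + snd p = real j + 3/2" "fst q + snd q = real j + 3/2"
           "fst p < a + 1" "fst q < a + 1" by (auto simp: Y_def)
        have "v * fst p + w * fst q + (v * snd p + w * snd q) = v * (fst p + snd p) + w * (fst q + snd q)"
          by (simp add: algebra_simps)
        also have "\<dots> = real j + 3/2" unfolding p using vw(3) by (simp flip: distrib_right)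
        finally have 1: "v * fst p + w * fst q + (v * snd p + w * snd q) = real j + 3/2" .
        have "v * fst p + w * fst q < a + 1" by (rule convex_bound_lt) (use p vw in auto)
        with 1 show "v *\<^sub>R p + w *\<^sub>R q \<in> Y" by (simp add: Y_def)
      qed
      then have "connected Y" by (rule convex_connected)
      moreover have "?p \<in> Y" using ab by (simp add: Y_def)
      moreover have "Y \<subseteq> - ?R"
      proof
        fix p assume p: "p \<in> Y"
        have ge: "xpos u d (real j + 3/2) \<ge> a + 1" if "d \<in> profiles u" "\<not> d ! j" for d
          using xpos_eq[of "Suc j" u "real j + 3/2" d] right[OF that(1)] X[of d] that(2) j by auto
        show "p \<in> - ?R"
          using p ge[OF c cj] ge[OF e ej] by (auto simp: Y_def mem_sym_diff_region)
      qed
      ultimately have "Y \<subseteq> connected_component_set (- ?R) ?p"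
        by (intro connected_component_maximal)
      with bd have "bounded Y" by (rule bounded_subset)
      then obtain B where B: "\<And>p. p \<in> Y \<Longrightarrow> norm p \<le> B" by (auto simp: bounded_iff)
      define r where "r = - \<bar>B\<bar> - \<bar>a\<bar> - 1"
      have "(r, real j + 3/2 - r) \<in> Y" by (auto simp: Y_def r_def)
      from B[OF this] norm_fst_le[of r "real j + 3/2 - r"] have "\<bar>r\<bar> \<le> B" by simp
      then show False by (auto simp: r_def)
    qed
  next
    assume cj: "c ! j"
    have "p \<in> strip u c ?e" if p: "a < fst p" "fst p < a + 1" "b < snd p" "snd p < b + 1" for p
    proof -
      let ?s = "fst p + snd p"
      have s: "real j < ?s" "?s < real j + 2" using p ab by linarith+
      show ?thesis
      proof (cases "?s \<le> real j + 1")
        case True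
        have x: "xpos u d ?s = real_of_int (fst (vertex u d j)) +
            real_of_int (fst (vertex u d (Suc j)) - fst (vertex u d j)) * (?s - real j)" for d
          by (rule xpos_eq) (use True s j in auto)
        \<comment> \<open>The path reaches \<open>x = a\<close> at level \<open>j + 1\<close>, the minimal path \<open>x = a + 1\<close>; both have slope 0 or 1.\<close>
        have "xpos u c ?s \<le> a" using x[of c] left[OF c] X[of c] cj True s by auto
        moreover have "xpos u ?e ?s \<ge> a + 1 - (real j + 1 - ?s)"
          using x[of ?e] left[OF e] X[of ?e] ej True s by auto
        ultimately show ?thesis using p ab by (simp add: strip_def)
      next
        case False
        have x: "xpos u d ?s = real_of_int (fst (vertex u d (Suc j))) +
            real_of_int (fst (vertex u d (Suc (Suc j))) - fst (vertex u d (Suc j))) * (?s - real (Suc j))" for d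
          by (rule xpos_eq) (use False s j in auto)
        have "xpos u c ?s \<le> a + (?s - real (Suc j))" using x[of c] right[OF c] X[of c] cj False s by auto
        moreover have "xpos u ?e ?s \<ge> a + 1"
          using x[of ?e] right[OF e] X[of ?e] ej False s by auto
        ultimately show ?thesis using p ab by (simp add: strip_def)
      qed
    qed
    then show "encloses ((path_of u c - path_of u ?e) \<union> (path_of u ?e - path_of u c)) (snake u ! j)"
      using strip_subset_inside[OF c e] unfolding encloses_def box sym_diff_region_def[symmetric] by blast
  qed
qed

section \<open>Summing over straight segments\<close>

definition profiles_from :: "letter list \<Rightarrow> bool \<Rightarrow> bool list set" where
  "profiles_from u x = {c \<in> profiles u. hd c = x}"

lemma profiles_from_Nil: "profiles_from [] x = {[x]}"
  by (auto simp: profiles_from_def profiles_def length_Suc_conv)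

lemma Cons_mem_profiles:
  "x # c \<in> profiles (y # u) \<longleftrightarrow> c \<in> profiles u \<and> compatible y x (hd c)"
proof -
  have "(\<forall>i<Suc (length u). compatible ((y # u) ! i) ((x # c) ! i) ((x # c) ! Suc i)) \<longleftrightarrow>
    compatible y x (c ! 0) \<and> (\<forall>i<length u. compatible (u ! i) (c ! i) (c ! Suc i))"
    by (subst All_less_Suc2) simp
  then show ?thesis by (cases c) (auto simp: profiles_def)
qed

lemma finite_profiles_from [simp]: "finite (profiles_from u x)"
  by (simp add: profiles_from_def)

lemma sum_profiles: "(\<Sum>c\<in>profiles u. f c) = (\<Sum>c\<in>profiles_from u True. f c) + (\<Sum>c\<in>profiles_from u False. f c)"
proof -
  have "profiles_from u True \<union> profiles_from u False = profiles u"
    by (auto simp: profiles_from_def)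
  moreover have "sum f (profiles_from u True \<union> profiles_from u False) =
      sum f (profiles_from u True) + sum f (profiles_from u False)"
    by (rule sum.union_disjoint) (auto simp: profiles_from_def)
  ultimately show ?thesis by simp
qed

text \<open>The transfer matrix step: peel off the first tile and split by the value at the next one.\<close>

lemma sum_profiles_from_Cons:
  fixes f :: "bool list \<Rightarrow> 'b :: comm_monoid_add"
  shows "(\<Sum>c\<in>profiles_from (y # u) x. f c) =
    (if compatible y x True then \<Sum>c\<in>profiles_from u True. f (x # c) else 0) +
    (if compatible y x False then \<Sum>c\<in>profiles_from u False. f (x # c) else 0)"
proof -
  let ?A = "\<lambda>b. if compatible y x b then profiles_from u b else {}"
  have "c \<in> profiles_from (y # u) x \<longleftrightarrow> c \<in> (#) x ` (?A True \<union> ?A False)" for c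
  proof (cases c)
    case Nil
    then show ?thesis by (auto simp: profiles_from_def profiles_def)
  next
    case (Cons z c')
    have "c' \<in> profiles u \<and> compatible y x (hd c') \<longleftrightarrow> c' \<in> ?A True \<union> ?A False"
      by (cases "hd c'") (auto simp: profiles_from_def)
    moreover have "c \<in> profiles_from (y # u) x \<longleftrightarrow> z = x \<and> c' \<in> profiles u \<and> compatible y x (hd c')"
      by (auto simp: Cons profiles_from_def Cons_mem_profiles)
    moreover have "c \<in> (#) x ` S \<longleftrightarrow> z = x \<and> c' \<in> S" for S by (auto simp: Cons)
    ultimately show ?thesis by simp
  qed
  then have "profiles_from (y # u) x = (#) x ` (?A True \<union> ?A False)" by blast
  then have "(\<Sum>c\<in>profiles_from (y # u) x. f c) = (\<Sum>c\<in>?A True \<union> ?A False. f (x # c))"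
    by (simp add: sum.reindex)
  also have "\<dots> = (\<Sum>c\<in>?A True. f (x # c)) + (\<Sum>c\<in>?A False. f (x # c))"
    by (rule sum.union_disjoint) (auto simp: profiles_from_def)
  finally show ?thesis by (simp split: if_splits)
qed

definition rank_from :: "letter list \<Rightarrow> bool \<Rightarrow> int poly" where
  "rank_from u x = (\<Sum>c\<in>profiles_from u x. qv ^ num_true c)"

lemma rank_from_Nil: "rank_from [] x = (if x then qv else 1)"
  by (simp add: rank_from_def profiles_from_Nil num_true_def)

lemma rank_from_Cons:
  "rank_from (y # u) x = (if x then qv else 1) *
    ((if compatible y x True then rank_from u True else 0) +
     (if compatible y x False then rank_from u False else 0))"
  unfolding rank_from_def sum_profiles_from_Cons
  by (simp add: num_true_def sum_distrib_left distrib_left)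

lemma qint_0 [simp]: "qint 0 = 0" by (simp add: qint_def)
lemma qint_Suc: "qint (Suc k) = qint k + qv ^ k" by (simp add: qint_def)
lemma sum_powers_shift:
  fixes x :: "'b :: comm_semiring_1"
  shows "(\<Sum>i<Suc k. x ^ i) = 1 + x * (\<Sum>i<k. x ^ i)"
  by (simp add: sum.lessThan_Suc_shift sum_distrib_left del: sum.lessThan_Suc)

lemma qint_Suc': "qint (Suc k) = 1 + qv * qint k"
  unfolding qint_def by (rule sum_powers_shift)

lemma qint_shift: "qint k + qv ^ k = 1 + qv * qint k"
  using qint_Suc qint_Suc' by metis

text \<open>Along a row the values increase: a leading \<open>True\<close> persists, and after a leading \<open>False\<close> the
  place of the jump, if any, is free. The possible places contribute consecutive powers of \<open>q\<close>,
  which add up to a \<open>q\<close>-integer.\<close>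

lemma rank_from_replicate_La:
  "rank_from (replicate l La @ v) True = qv ^ l * rank_from v True"
  "rank_from (replicate l La @ v) False = rank_from v False + qint l * rank_from v True"
proof (induction l)
  case (Suc l)
  show "rank_from (replicate (Suc l) La @ v) True = qv ^ Suc l * rank_from v True"
    using Suc(1) by (simp add: rank_from_Cons algebra_simps)
  show "rank_from (replicate (Suc l) La @ v) False = rank_from v False + qint (Suc l) * rank_from v True"
    using Suc by (simp add: rank_from_Cons qint_Suc algebra_simps)
qed simp_all

text \<open>Along a column the values decrease. The extra factor \<open>q\<close> is that of the leading \<open>True\<close>, which is
  present whatever the place of the jump.\<close>

lemma rank_from_replicate_Lb:
  "rank_from (replicate l Lb @ v) False = rank_from v False"
  "rank_from (replicate l Lb @ v) True = qv ^ l * rank_from v True + qv * qint l * rank_from v False"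
proof (induction l)
  case (Suc l)
  show 1: "rank_from (replicate (Suc l) Lb @ v) False = rank_from v False"
    using Suc(1) by (simp add: rank_from_Cons)
  have "rank_from (replicate (Suc l) Lb @ v) True =
      qv * (rank_from (replicate l Lb @ v) True + rank_from (replicate l Lb @ v) False)"
    by (simp add: rank_from_Cons)
  also have "\<dots> = qv ^ Suc l * rank_from v True + qv * (1 + qv * qint l) * rank_from v False"
    unfolding Suc by (simp only: power_Suc distrib_left distrib_right mult.assoc mult_1_left mult_1_right add.assoc add.commute)
  finally show "rank_from (replicate (Suc l) Lb @ v) True =
      qv ^ Suc l * rank_from v True + qv * qint (Suc l) * rank_from v False"
    unfolding qint_Suc' .
qed simp_all

text \<open>The part of a shape that starts at a corner tile, reconstructed from the directions and the numbers
  \<open>k\<^sub>i\<close> of the segments from there on. A block of \<open>l\<close> letters has \<open>k\<^sub>i = l\<close>, except for the last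
  one, where \<open>k\<^sub>i = l + 1\<close>.\<close>

fun segment_word :: "(letter \<times> nat) list \<Rightarrow> letter list" where
  "segment_word [] = []"
| "segment_word [(y, k)] = replicate (k - 1) y"
| "segment_word ((y, k) # p # ps) = replicate k y @ segment_word (p # ps)"

text \<open>The contribution of the steps \<open>i \<ge> j\<close> of the middle path and of the tiles \<open>i \<ge> j\<close> to the weight of a
  zigzag path. The data are those of the segments \<open>i \<ge> j\<close>, and the Boolean word starts with the value at
  tile \<open>j - 1\<close>. If segment \<open>i\<close> has direction \<open>y\<close>, then step \<open>i\<close> of the middle path has direction \<open>flip y\<close>; its
  starting point is on the path iff the value at tile \<open>i - 1\<close> is \<open>(y = Lb)\<close>, its end point iff the value
  at tile \<open>i\<close> is \<open>(y = La)\<close>. The last point of the middle path is on every path, whence the first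
  equation; the last equation covers arguments that do not occur.\<close>

fun tail_weight :: "(letter \<times> nat) list \<Rightarrow> bool list \<Rightarrow> int poly" where
  "tail_weight [(y, k)] [x] = (if x = (y = Lb) then qint k else 1)"
| "tail_weight ((y, k) # (y', k') # ps) (x # x' # c) =
     (if x = (y = Lb) \<and> x' = (y = La) then qint k else 1) *
     (if x' then if y = La then qv else qv ^ (k + k' - 1) else 1) *
     tail_weight ((y', k') # ps) (x' # c)"
| "tail_weight _ _ = 0"

text \<open>The share of the face weight of tile \<open>j - 1\<close> that is due to segment \<open>j\<close>. When the two steps are
  the S and E sides, the weight \<open>q ^ (k\<^sub>j\<^sub>-\<^sub>1 + k\<^sub>j - 1)\<close> comes from \<open>True\<close>s on two segments; \<open>q ^ k\<^sub>j\<close>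
  is the part that lies on segment \<open>j\<close>, including the corner. When they are the W and N sides, the
  weight \<open>q\<close> is that of the corner and is not split.\<close>

definition half_face :: "letter \<Rightarrow> nat \<Rightarrow> bool \<Rightarrow> int poly" where
  "half_face y k x = (if x then if y = La then qv ^ k else qv else 1)"

text \<open>Rank generating functions of \<open>G\<^sub>w\<close> cut off at a corner tile correspond to cut-off zigzag
  weights. In the induction step one more segment is attached in front: its values are summed out by
  \<open>rank_from_replicate_La\<close> or \<open>rank_from_replicate_Lb\<close>, and the result has the form of one further
  step of \<open>tail_weight\<close>.\<close>

lemma rank_from_segment_word:
  assumes "distinct_adj (map fst ps)" "\<forall>(y, k)\<in>set ps. 0 < k" "ps \<noteq> []"
  shows "rank_from (segment_word ps) x =
    half_face (fst (hd ps)) (snd (hd ps)) x *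
    (\<Sum>c\<in>profiles_from (butlast (map fst ps)) x. tail_weight ps c)"
  using assms
proof (induction ps arbitrary: x rule: segment_word.induct)
  case (2 y k)
  then obtain l where k: "k = Suc l" by (cases k) auto
  show ?case
    using rank_from_replicate_La[of l "[]"] rank_from_replicate_Lb[of l "[]"] qint_shift[of l]
    by (cases y; cases x)
       (simp_all add: k profiles_from_Nil rank_from_Nil half_face_def qint_Suc algebra_simps
          one_pCons)
next
  case (3 y k p ps)
  obtain y' k' where p: "p = (y', k')" by fastforce
  have y': "y' = flip y" using 3(2) p by (cases y; cases y') auto
  have k: "0 < k" "0 < k'" using 3(3) p by auto
  define T where "T b = (\<Sum>c\<in>profiles_from (butlast (map fst (p # ps))) b. tail_weight (p # ps) c)" for b
  have IH: "rank_from (segment_word (p # ps)) b = half_face y' k' b * T b" for b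
    using 3(1)[of b] 3(2,3) p by (simp add: T_def)
  have hd: "(\<Sum>c\<in>profiles_from (butlast (map fst (p # ps))) b. tail_weight ((y, k) # p # ps) (x # c)) =
      (if x = (y = Lb) \<and> b = (y = La) then qint k else 1) *
      (if b then if y = La then qv else qv ^ (k + k' - 1) else 1) * T b" for b
    unfolding T_def sum_distrib_left
  proof (rule sum.cong[OF refl])
    fix c assume c: "c \<in> profiles_from (butlast (map fst (p # ps))) b"
    then have "c \<noteq> []" "hd c = b" by (auto simp: profiles_from_def profiles_def)
    then obtain c' where "c = b # c'" by (cases c) auto
    then show "tail_weight ((y, k) # p # ps) (x # c) =
       (if x = (y = Lb) \<and> b = (y = La) then qint k else 1) *
       (if b then if y = La then qv else qv ^ (k + k' - 1) else 1) * tail_weight (p # ps) c"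
      by (simp add: p)
  qed
  have bl: "butlast (map fst ((y, k) # p # ps)) = y # butlast (map fst (p # ps))" by simp
  obtain l where l: "k = Suc l" using k by (cases k) auto
  have pw: "qv ^ (k + k' - 1) = qv ^ l * qv ^ k'" by (simp add: l power_add)
  have kl: "qv ^ k = qv * qv ^ l" by (simp add: l)
  show ?case
    unfolding bl sum_profiles_from_Cons hd pw
    by (cases y; cases x)
       (simp_all add: y' rank_from_replicate_La rank_from_replicate_Lb IH half_face_def kl
         algebra_simps)
qed simp

text \<open>Attaching the first segment. It has no corner tile at its beginning, but behaves like a segment of
  \<open>tail_weight\<close> whose starting point is on the path, hence the artificial first value \<open>(fst p = Lb)\<close>.\<close>

lemma rank_sum_segment_word:
  assumes "distinct_adj (map fst (p # ps))" "\<forall>(y, k)\<in>set (p # ps). 0 < k" "ps \<noteq> []"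
  shows "(\<Sum>c\<in>profiles (replicate (snd p - 1) (fst p) @ segment_word ps). qv ^ num_true c) =
    (\<Sum>c\<in>profiles (butlast (map fst ps)). tail_weight (p # ps) ((fst p = Lb) # c))"
proof -
  obtain y k where p: "p = (y, k)" by fastforce
  obtain y' k' ps' where ps: "ps = (y', k') # ps'" using assms(3) by (cases ps) auto
  have y': "y' = flip y" using assms(1) p ps by (cases y; cases y') auto
  obtain l where l: "k = Suc l" using assms(2) p by (cases k) auto
  define T where "T b = (\<Sum>c\<in>profiles_from (butlast (map fst ps)) b. tail_weight ps c)" for b
  have IH: "rank_from (segment_word ps) b = half_face y' k' b * T b" for b
    using rank_from_segment_word[of ps b] assms ps p by (simp add: T_def)
  have hd: "(\<Sum>c\<in>profiles_from (butlast (map fst ps)) b. tail_weight (p # ps) ((y = Lb) # c)) =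
      (if b = (y = La) then qint k else 1) *
      (if b then if y = La then qv else qv ^ (k + k' - 1) else 1) * T b" for b
    unfolding T_def sum_distrib_left
  proof (rule sum.cong[OF refl])
    fix c assume c: "c \<in> profiles_from (butlast (map fst ps)) b"
    then have "c \<noteq> []" "hd c = b" by (auto simp: profiles_from_def profiles_def)
    then obtain c' where "c = b # c'" by (cases c) auto
    then show "tail_weight (p # ps) ((y = Lb) # c) =
       (if b = (y = La) then qint k else 1) *
       (if b then if y = La then qv else qv ^ (k + k' - 1) else 1) * tail_weight ps c"
      by (simp add: p ps)
  qed
  have pw: "qv ^ (k + k' - 1) = qv ^ l * qv ^ k'" by (simp add: l power_add)
  show ?thesis
    unfolding sum_profiles rank_from_def[symmetric] p fst_conv snd_conv
    unfolding hd[unfolded p] pw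
    using arg_cong[OF qint_shift[of l], of "\<lambda>z. z * T True"]
      arg_cong[OF qint_shift[of l], of "\<lambda>z. z * T False"]
    by (cases y)
       (simp_all add: y' rank_from_replicate_La rank_from_replicate_Lb IH half_face_def l
          qint_Suc algebra_simps)
qed

lemma tail_weight_eq_prod:
  assumes "length c = length ps" "ps \<noteq> []"
  shows "tail_weight ps c =
    (\<Prod>i<length ps. if c ! i = (fst (ps ! i) = Lb) \<and>
         (Suc i < length ps \<longrightarrow> c ! Suc i = (fst (ps ! i) = La)) then qint (snd (ps ! i)) else 1) *
    (\<Prod>i<length ps - 1. if c ! Suc i
         then if fst (ps ! i) = La then qv else qv ^ (snd (ps ! i) + snd (ps ! Suc i) - 1) else 1)"
  using assms
proof (induction ps c rule: tail_weight.induct)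
  case (2 y k y' k' ps x x' c)
  then show ?case
    by (simp add: prod.lessThan_Suc_shift mult_ac del: prod.lessThan_Suc cong: if_cong
          split del: if_split)
qed (auto simp: length_Suc_conv)

section \<open>The segments of a shape\<close>

lemma concat_runs: "concat (runs xs) = xs"
  by (induction xs rule: runs.induct) simp_all

lemma runs_constant: "r \<in> set (runs xs) \<Longrightarrow> r = replicate (length r) (hd r) \<and> r \<noteq> []"
proof (induction xs rule: runs.induct)
  case (2 x xs)
  have "takeWhile (\<lambda>y. y = x) xs = replicate (length (takeWhile (\<lambda>y. y = x) xs)) x"
    by (rule replicate_eqI) (auto dest: set_takeWhileD)
  then show ?case using 2 by (auto simp del: takeWhile_eq_Nil_iff)
qed simp

lemma segment_word_eq_concat:
  assumes "length ps = length rs"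
    and "\<And>i. i < length rs \<Longrightarrow>
      rs ! i = replicate (if Suc i = length rs then snd (ps ! i) - 1 else snd (ps ! i)) (fst (ps ! i))"
  shows "segment_word ps = concat rs"
  using assms
proof (induction ps arbitrary: rs rule: segment_word.induct)
  case (2 y k)
  from 2(1) obtain r where "rs = [r]" by (cases rs) auto
  then show ?case using 2(2)[of 0] by simp
next
  case (3 y k p ps)
  from 3(2) obtain r rs' where rs: "rs = r # rs'" "length rs' = Suc (length ps)"
    by (cases rs) auto
  have "segment_word (p # ps) = concat rs'"
    by (rule 3(1)) (use rs 3(3)[of "Suc _"] in auto)
  moreover have "r = replicate k y" using rs 3(3)[of 0] by simp
  ultimately show ?case using rs by simp
qed simp

definition segment_data :: "letter list \<Rightarrow> (letter \<times> nat) list" where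
  "segment_data w = map (\<lambda>i. (hd (segments w ! i), seg_k w i)) [0..<num_segments w]"

lemma length_segment_data [simp]: "length (segment_data w) = num_segments w"
  by (simp add: segment_data_def)

lemma segment_data_nth:
  "i < num_segments w \<Longrightarrow> segment_data w ! i = (hd (segments w ! i), seg_k w i)"
  by (simp add: segment_data_def)

lemma map_fst_segment_data: "map fst (segment_data w) = map hd (segments w)"
  by (rule nth_equalityI) (simp_all add: segment_data_nth num_segments_def)

lemma distinct_adj_segment_data: "distinct_adj (map fst (segment_data w))"
  unfolding map_fst_segment_data segments_def by (rule distinct_adj_runs)

lemma segment_nth:
  assumes "i < num_segments w"
  shows "segments w ! i = replicate (length (segments w ! i)) (hd (segments w ! i))" "segments w ! i \<noteq> []"
  using runs_constant[of "segments w ! i" "word_star w"] assms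
  by (auto simp: segments_def num_segments_def)

lemma seg_k_pos: "i < num_segments w \<Longrightarrow> 0 < seg_k w i"
  using segment_nth(2)[of i w] by (auto simp: seg_k_def segment_tiles_def)

text \<open>The first and the last segment have one letter less than \<open>k\<close>, which \<open>segment_word\<close> takes care of at the end
  only; hence the separate treatment of the first one.\<close>

lemma word_star_eq_segment_word:
  assumes "num_segments w \<ge> 2" "segment_data w = p # ps"
  shows "word_star w = replicate (snd p - 1) (fst p) @ segment_word ps"
proof -
  obtain r rs where rs: "segments w = r # rs"
    using assms(1) by (cases "segments w") (auto simp: num_segments_def)
  have len: "length ps = length rs"
    using arg_cong[OF assms(2), of length] rs by (simp add: num_segments_def)
  have d: "num_segments w = Suc (length rs)" using rs by (simp add: num_segments_def)
  have "segment_word ps = concat rs"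
  proof (rule segment_word_eq_concat[OF len])
    fix i assume i: "i < length rs"
    have "ps ! i = (hd (rs ! i), seg_k w (Suc i))"
      using segment_data_nth[of "Suc i" w] i assms(2) rs d by simp
    moreover have "seg_k w (Suc i) = (if Suc i = length rs then length (rs ! i) + 1 else length (rs ! i))"
    proof -
      have "segments w ! Suc i = rs ! i" using rs by simp
      then show ?thesis unfolding seg_k_def segment_tiles_def
        by (cases "Suc i = length rs") (simp_all add: d)
    qed
    ultimately show "rs ! i = replicate (if Suc i = length rs then snd (ps ! i) - 1 else snd (ps ! i)) (fst (ps ! i))"
      using segment_nth(1)[of "Suc i" w] i rs d by simp
  qed
  moreover have "p = (hd r, length r + 1)"
    using segment_data_nth[of 0 w] assms(2) rs d by (simp add: seg_k_def segment_tiles_def)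
  then have "replicate (snd p - 1) (fst p) = r"
    using segment_nth(1)[of 0 w] rs d by simp
  ultimately show ?thesis
    using concat_runs[of "word_star w"] rs by (simp add: segments_def)
qed

section \<open>The middle path and the path weights\<close>

lemma length_middle_dirs [simp]: "length (middle_dirs w) = num_segments w"
  by (simp add: middle_dirs_def num_segments_def)

lemma middle_dirs_nth:
  "i < num_segments w \<Longrightarrow> middle_dirs w ! i = flip (fst (segment_data w ! i))"
  by (simp add: middle_dirs_def num_segments_def segment_data_nth)

lemma neq_flip: "x \<noteq> y \<longleftrightarrow> y = flip x"
  by (cases x; cases y) auto

lemma middle_dirs_Suc:
  assumes "Suc i < num_segments w"
  shows "middle_dirs w ! Suc i = flip (middle_dirs w ! i)"
  using distinct_adj_middle_dirs[of w] assms neq_flip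
  by (auto simp: distinct_adj_conv_nth)

lemma flip_flip [simp]: "flip (flip x) = x"
  by (cases x) auto

definition zigzag_shape :: "letter list \<Rightarrow> letter list" where
  "zigzag_shape w = take (num_segments w - 2) (middle_dirs w)"

text \<open>Directions alternate and the middle path is a reflection of the sequence of segments, so its step \<open>i\<close>
  points in the direction of segment \<open>i + 1\<close>. This matches the index shift in \<open>rank_sum_segment_word\<close>.\<close>

lemma zigzag_shape_eq:
  "zigzag_shape w = butlast (map fst (tl (segment_data w)))"
proof (rule nth_equalityI)
  show "length (zigzag_shape w) = length (butlast (map fst (tl (segment_data w))))"
    by (simp add: zigzag_shape_def)
  fix i assume "i < length (zigzag_shape w)"
  then have i: "i < num_segments w - 2" by (simp add: zigzag_shape_def)
  then have "fst (segment_data w ! Suc i) = middle_dirs w ! i"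
    using middle_dirs_nth[of "Suc i" w] middle_dirs_Suc[of i w] by simp
  then show "zigzag_shape w ! i = butlast (map fst (tl (segment_data w))) ! i"
    using i by (simp add: zigzag_shape_def nth_butlast nth_tl)
qed

definition middle_point :: "letter list \<Rightarrow> nat \<Rightarrow> point" where
  "middle_point w i = points_from (0, 0) (middle_dirs w) ! i"

lemma steps_from_nth:
  "i < length u \<Longrightarrow> steps_from p u ! i = (points_from p u ! i, points_from p u ! Suc i)"
proof (induction u arbitrary: p i)
  case (Cons x u)
  then show ?case by (cases i) auto
qed simp

lemma length_steps_from [simp]: "length (steps_from p u) = length u"
  by (induction u arbitrary: p) auto

lemma points_from_take: "i \<le> k \<Longrightarrow> k \<le> length u \<Longrightarrow> points_from p (take k u) ! i = points_from p u ! i"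
proof (induction u arbitrary: p i k)
  case (Cons x u)
  then show ?case by (cases i; cases k) auto
qed simp

lemma length_middle_path [simp]: "length (middle_path w) = num_segments w"
  by (simp add: middle_path_def)

lemma middle_path_nth:
  "i < num_segments w \<Longrightarrow> middle_path w ! i = (middle_point w i, middle_point w (Suc i))"
  by (simp add: middle_path_def middle_point_def steps_from_nth)

lemma middle_point_0 [simp]: "middle_point w 0 = (0, 0)"
  by (simp add: middle_point_def)

lemma middle_point_Suc:
  "i < num_segments w \<Longrightarrow> middle_point w (Suc i) = move (middle_dirs w ! i) (middle_point w i)"
  by (simp add: middle_point_def points_from_Suc)

lemma level_middle_point: "i \<le> num_segments w \<Longrightarrow> level (middle_point w i) = int i"
  by (simp add: middle_point_def level_points_from) (simp add: level_def)

lemma zigzag_snake_eq: "zigzag_snake w = snake (zigzag_shape w)"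
  by (simp add: zigzag_snake_def zigzag_shape_def)

lemma zigzag_snake_nth:
  "i \<le> num_segments w - 2 \<Longrightarrow> snake (zigzag_shape w) ! i = middle_point w i"
  by (simp add: snake_def zigzag_shape_def middle_point_def points_from_take)

context
  fixes w :: "letter list" and c :: "bool list"
  assumes d: "num_segments w \<ge> 2" and c: "c \<in> profiles (zigzag_shape w)"
begin

lemma length_zigzag_shape: "length (zigzag_shape w) + 2 = num_segments w"
  using d by (simp add: zigzag_shape_def)

text \<open>The middle path passes through a corner of each tile: NW if its step there goes up, which
  happens iff the corresponding segment is a row, and SE otherwise. Its last point is the end of every path.\<close>

lemma vertex_eq_middle_point_iff:
  assumes "i < num_segments w"
  shows "vertex (zigzag_shape w) c (Suc i) = middle_point w (Suc i) \<longleftrightarrow>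
    (Suc i < num_segments w \<longrightarrow> c ! i = (fst (segment_data w ! i) = La))"
proof (cases "Suc i < num_segments w")
  case True
  then have "i \<le> length (zigzag_shape w)" using length_zigzag_shape by simp
  moreover have "middle_point w (Suc i) = corner (middle_point w i) (fst (segment_data w ! i) = La)"
    using True by (cases "fst (segment_data w ! i)")
      (simp_all add: middle_point_Suc middle_dirs_nth corner_def)
  ultimately show ?thesis
    using True length_zigzag_shape by (simp add: vertex_Suc zigzag_snake_nth)
next
  case False
  then have i: "i = Suc (length (zigzag_shape w))" using assms length_zigzag_shape by simp
  let ?m = "length (zigzag_shape w)"
  have i0: "?m < num_segments w" and i1: "Suc ?m < num_segments w" and i2: "?m \<le> num_segments w - 2"
    using length_zigzag_shape by linarith+
  have "middle_point w (Suc (Suc ?m)) = move (flip (middle_dirs w ! ?m)) (move (middle_dirs w ! ?m) (middle_point w ?m))"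
    by (simp add: middle_point_Suc[OF i1] middle_point_Suc[OF i0] middle_dirs_Suc[OF i1])
  also have "\<dots> = move La (move Lb (middle_point w ?m))"
    by (cases "middle_dirs w ! ?m") (simp_all add: move_commute)
  finally have "vertex (zigzag_shape w) c (Suc (Suc ?m)) = middle_point w (Suc (Suc ?m))"
    unfolding vertex_end zigzag_snake_nth[OF i2] by (rule sym)
  then show ?thesis using False unfolding i by simp
qed

text \<open>As both paths have one edge per level, the \<open>i\<close>-th edge of a path can only be the \<open>i\<close>-th step of the
  middle path. The value put in front of \<open>c\<close> says that the common starting point is on the middle path.\<close>

lemma edge_weight_path_edge:
  fixes C defines "C \<equiv> (fst (segment_data w ! 0) = Lb) # c"
  assumes i: "i < num_segments w"
  shows "edge_weight w (path_edge (zigzag_shape w) c i) =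
    (if C ! i = (fst (segment_data w ! i) = Lb) \<and>
        (Suc i < num_segments w \<longrightarrow> C ! Suc i = (fst (segment_data w ! i) = La))
     then qint (snd (segment_data w ! i)) else 1)"
proof -
  let ?e = "path_edge (zigzag_shape w) c i"
  have lev: "level (fst ?e) = int i"
    using level_path_edge length_zigzag_shape i by simp
  have mid: "k = i" if "k < num_segments w" "middle_path w ! k = ?e" for k
    using that lev level_middle_point[of k w] by (simp add: middle_path_nth flip: that(2))
  have start: "vertex (zigzag_shape w) c i = middle_point w i \<longleftrightarrow> C ! i = (fst (segment_data w ! i) = Lb)"
  proof (cases i)
    case (Suc k)
    then have "fst (segment_data w ! i) = flip (fst (segment_data w ! k))"
      using middle_dirs_nth[of k w] middle_dirs_nth[of i w] middle_dirs_Suc[of k w] i by simp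
    then have "fst (segment_data w ! i) = Lb \<longleftrightarrow> fst (segment_data w ! k) = La"
      by (cases "fst (segment_data w ! k)") auto
    then show ?thesis using vertex_eq_middle_point_iff[of k] Suc i by (simp add: C_def)
  qed (simp add: C_def)
  have "?e = middle_path w ! i \<longleftrightarrow> C ! i = (fst (segment_data w ! i) = Lb) \<and>
        (Suc i < num_segments w \<longrightarrow> C ! Suc i = (fst (segment_data w ! i) = La))"
    unfolding start[symmetric]
    using vertex_eq_middle_point_iff[OF i] i
    by (simp add: path_edge_def middle_path_nth C_def)
  moreover have "?e \<in> set (middle_path w) \<longleftrightarrow> ?e = middle_path w ! i"
    using mid i by (metis in_set_conv_nth length_middle_path)
  moreover have "(THE k. k < num_segments w \<and> middle_path w ! k = ?e) = i" if "?e = middle_path w ! i"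
    using that mid i by (intro the_equality) auto
  ultimately show ?thesis
    using i by (auto simp: edge_weight_def segment_data_nth)
qed

lemma face_weight_eq:
  assumes j: "j < num_segments w - 1"
  shows "face_weight w j = (if fst (segment_data w ! j) = La then qv
    else qv ^ (snd (segment_data w ! j) + snd (segment_data w ! Suc j) - 1))"
proof -
  let ?t = "middle_point w j"
  have t: "zigzag_snake w ! j = ?t" using j by (simp add: zigzag_snake_eq zigzag_snake_nth)
  have "middle_path w ! j = W_edge ?t \<and> middle_path w ! Suc j = N_edge ?t \<longleftrightarrow>
      fst (segment_data w ! j) = La"
    using j middle_dirs_Suc[of j w] middle_dirs_nth[of j w]
    by (cases "fst (segment_data w ! j)")
       (auto simp: middle_path_nth middle_point_Suc W_edge_def N_edge_def)
  then show ?thesis using j by (simp add: face_weight_def t segment_data_nth)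
qed

text \<open>Edges are enumerated by their levels, and the enclosed tiles are those with value \<open>True\<close>, so both
  products become products over indices.\<close>

lemma path_weight_eq_tail_weight:
  "path_weight w (path_of (zigzag_shape w) c) =
    tail_weight (segment_data w) ((fst (segment_data w ! 0) = Lb) # c)"
proof -
  let ?u = "zigzag_shape w" and ?C = "(fst (segment_data w ! 0) = Lb) # c"
  have len: "length ?u + 2 = num_segments w" by (rule length_zigzag_shape)
  have "(\<Prod>e\<in>path_of ?u c. edge_weight w e) = (\<Prod>i<num_segments w. edge_weight w (path_edge ?u c i))"
    unfolding path_of_def by (subst prod.reindex[OF inj_on_path_edge]) (simp only: len o_def)
  moreover have "enclosed_tiles w (path_of ?u c) = {j \<in> {..<num_segments w - 1}. c ! j}"
    using encloses_iff[OF c] len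
    by (auto simp: enclosed_tiles_def zigzag_snake_eq min_path_snake Let_def)
  then have "(\<Prod>j\<in>enclosed_tiles w (path_of ?u c). face_weight w j) =
      (\<Prod>j<num_segments w - 1. if c ! j then face_weight w j else 1)"
    by (simp only: prod.inter_filter[OF finite_lessThan])
  moreover have "length ?C = length (segment_data w)" using length_profile[OF c] len by simp
  moreover have "segment_data w \<noteq> []" using d by (simp flip: length_0_conv)
  ultimately show ?thesis
    unfolding path_weight_def
    by (subst tail_weight_eq_prod) (simp_all add: edge_weight_path_edge face_weight_eq cong: if_cong)
qed

end

section \<open>The rank function as a weighted sum\<close>

theorem theorem8p5:
  fixes w :: "letter list" and d :: nat
  assumes "num_segments w = d" and "d \<ge> 2"
  shows "rank_function (snake_G w) =
    (\<Sum>L\<in>lattice_paths (zigzag_snake w). path_weight w L)"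
proof -
  have d: "num_segments w \<ge> 2" using assms by simp
  obtain p ps where ps: "segment_data w = p # ps" "ps \<noteq> []"
  proof (cases "segment_data w")
    case Nil
    then show ?thesis using d by (simp flip: length_segment_data)
  next
    case (Cons p ps)
    then have "2 \<le> length (p # ps)" using d length_segment_data[of w] by simp
    then show ?thesis using Cons that by (cases ps) auto
  qed
  have pos: "\<forall>(y, k)\<in>set (p # ps). 0 < k"
    unfolding ps(1)[symmetric] by (auto simp: segment_data_def seg_k_pos)
  have "rank_function (snake_G w) = (\<Sum>c\<in>profiles (word_star w). qv ^ num_true c)"
    by (simp add: snake_G_def rank_function_snake)
  also have "\<dots> = (\<Sum>c\<in>profiles (butlast (map fst ps)). tail_weight (p # ps) ((fst p = Lb) # c))"
    unfolding word_star_eq_segment_word[OF d ps(1)]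
    by (rule rank_sum_segment_word) (use distinct_adj_segment_data[of w] ps pos in auto)
  also have "\<dots> = (\<Sum>c\<in>profiles (zigzag_shape w). path_weight w (path_of (zigzag_shape w) c))"
  proof (rule sum.cong)
    show shape: "profiles (butlast (map fst ps)) = profiles (zigzag_shape w)"
      by (simp add: zigzag_shape_eq ps)
    fix c assume "c \<in> profiles (zigzag_shape w)"
    then show "tail_weight (p # ps) ((fst p = Lb) # c) = path_weight w (path_of (zigzag_shape w) c)"
      using path_weight_eq_tail_weight[OF d] ps by simp
  qed
  also have "\<dots> = (\<Sum>L\<in>lattice_paths (zigzag_snake w). path_weight w L)"
    by (simp add: zigzag_snake_eq lattice_paths_snake sum.reindex[OF inj_on_path_of])
  finally show ?thesis .
qed

end
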